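(* For $\hat v_p,\hat v_s,\hat\zeta_p,\hat\zeta_s\in H^1(\Omega_2)$, the sesquilinear form $$\breve{\mathcal A}_{\Omega_2}(\hat v_p,\hat v_s;\hat\zeta_p,\hat\zeta_s)=\sum_{t\in\{p,s\}}\Big[\big(\mathbb A\nabla(w_t\hat v_t),\nabla(\tfrac r\tau w_t\hat\zeta_t)\big)_{\Omega_2}-k_t^2(\tau_r\hat v_t,\hat\zeta_t)_{\Omega_2}\Big]$$ can be rewritten as $\breve{\mathcal A}_{\Omega_2}(\hat v_p,\hat v_s;\hat\zeta_p,\hat\zeta_s)=\breve{\mathcal A}^p_{\Omega_2}(\hat v_p;\hat\zeta_p)+\breve{\mathcal A}^s_{\Omega_2}(\hat v_s;\hat\zeta_s)$, where, for $t=p,s$, $$\breve{\mathcal A}^t_{\Omega_2}(\hat v_t;\hat\zeta_t)=\big(\tfrac r\tau\mathbb A\nabla\hat v_t,\nabla\hat\zeta_t\big)_{\Omega_2}+\big(\mathbb R_\vartheta\mathbf p\cdot\nabla\hat v_t,\hat\zeta_t\big)_{\Omega_2}+\big(\hat v_t,\mathbb R_\vartheta\mathbf q^*\cdot\nabla\hat\zeta_t\big)_{\Omega_2}+(\breve n\,\hat v_t,\hat\zeta_t)_{\Omega_2},$$ with $$\mathbf p:=w_t\,\mathbb B\,\widehat\nabla\big(\tfrac{r w_t^*}{\tau}\big),\qquad \mathbf q:=\tfrac{r w_t^*}{\tau}\,\mathbb B\,\widehat\nabla w_t,\qquad \breve n:=(\widehat\nabla w_t)^\top\mathbb B\,\widehat\nabla\big(\tfrac{rw_t^*}{\tau}\big)-k_t^2\tau_r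 .$$ Furthermore, in $\Omega_2$, $$\mathbb B=\begin{bmatrix}\frac{\tau}{r\tau_r}+\frac{\tau_\vartheta^2}{r\tau_r\tau}&-\frac{\tau_\vartheta}{\tau}\\ -\frac{\tau_\vartheta}{\tau}&\frac{r\tau_r}{\tau}\end{bmatrix},$$ and $\mathbf p=(p_1,p_2)^\top$, $\mathbf q=(q_1,q_2)^\top$, $\breve n$ are given by $$p_1=\frac1{r\tau_r}-\frac1\tau-\mathrm ik_t-\frac{\mathrm ik_t\tau_\vartheta a_\vartheta}{\tau^2}+\frac{\tau_\vartheta^2}{r\tau_r\tau^2},\qquad p_2=-\frac{\tau_\vartheta}{\tau^2}+\frac{\mathrm ik_tr\tau_ra_\vartheta}{\tau^2},$$ $$q_1=\mathrm ik_t+\frac{\mathrm ik_ta_\vartheta\tau_\vartheta}{\tau^2},\qquad q_2=-\frac{\mathrm ik_tr\tau_ra_\vartheta}{\tau^2},\qquad \breve n=\mathrm ik_t\Big(\frac1r-\frac{\tau_r}{\tau}+\frac{\tau_\vartheta a_\vartheta}{\tau^2r}-\frac{\mathrm ik_t\tau_ra_\vartheta^2}{\tau^2}\Big).$$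
   Context: $(r,\vartheta)$ are polar coordinates in $\mathbb R^2$. $a(\vartheta)>0$ and $b(\vartheta)>a(\vartheta)$ are radial functions describing star-shaped closed curves, and $\Omega_2=\{a(\vartheta)<r<b(\vartheta)\}$. For a parameter $\tau_0>0$, in $\Omega_2$ put $\tau(r,\vartheta)=a(\vartheta)e^{\tau_0(r-a(\vartheta))}$. Subscripts $r,\vartheta$ denote partial derivatives: $\tau_r=\partial_r\tau$, $\tau_\vartheta=\partial_\vartheta\tau$, $a_\vartheta=a'(\vartheta)$. The map $(r\cos\vartheta,r\sin\vartheta)\mapsto(\tau\cos\vartheta,\tau\sin\vartheta)$ has Jacobian matrix $$\mathbb J=\mathbb R_\vartheta\begin{bmatrix}\tau_r&\tau_\vartheta/r\\0&\tau/r\end{bmatrix}\mathbb R_\vartheta^\top,\qquad \mathbb R_\vartheta=\begin{bmatrix}\cos\vartheta&-\sin\vartheta\\ \sin\vartheta&\cos\vartheta\end{bmatrix},$$ $J=\det\mathbb J=\tau\tau_r/r$ and $\mathbb A=J\,\mathbb J^{-1}\mathbb J^{-\top}$. The matrix $\mathbb B=\mathbb R_\vartheta^\top\mathbb A\mathbb R_\vartheta$. Further, $\widehat\nabla=(\partial_r,\tfrac1r\partial_\vartheta)^\top$, so that $\nabla=\mathbb R_\vartheta\widehat\nabla$. The wavenumbers $k_p,k_s>0$ are $k_p=\omega\sqrt{\rho/(\lambda+2\mu)}$ and $k_s=\omega\sqrt{\rho/\mu}$ (with $\omega,\rho,\mu>0$, $\lambda+\mu>0$). For $t=p,s$, $w_t=e^{\mathrm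 ik_t(\tau(r,\vartheta)-a(\vartheta))}$ in $\Omega_2$. The superscript $*$ denotes (componentwise) complex conjugation. The vectors $\mathbf p,\mathbf q$ and the scalar $\breve n$ depend on $t$. Inner products: $(P,Q)_{\Omega_2}=\int_{\Omega_2}P\overline Q\,d\mathbf x$ for scalars and $(\mathbf P,\mathbf Q)_{\Omega_2}=\int_{\Omega_2}\mathbf P\cdot\overline{\mathbf Q}\,d\mathbf x$ for vectors; the dot product $\cdot$ itself is the bilinear (unconjugated) one. *)

theory Defs
  imports "HOL-Analysis.Analysis"
begin

section \<open>The Sobolev space \<open>H\<^sup>1\<close> on a plane domain\<close>

definition partial_deriv :: "2 \<Rightarrow> (real^2 \<Rightarrow> real) \<Rightarrow> real^2 \<Rightarrow> real" where
  "partial_deriv i f x = frechet_derivative f (at x) (axis i 1)"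

primrec Ck :: "nat \<Rightarrow> (real^2 \<Rightarrow> real) \<Rightarrow> bool" where
  "Ck 0 f = continuous_on UNIV f"
| "Ck (Suc n) f = ((\<forall>x. f differentiable (at x)) \<and> (\<forall>i. Ck n (partial_deriv i f)))"

definition test_function :: "(real^2) set \<Rightarrow> (real^2 \<Rightarrow> real) \<Rightarrow> bool" where
  "test_function \<Omega> \<phi> \<longleftrightarrow>
     (\<forall>n. Ck n \<phi>) \<and> compact (closure {x. \<phi> x \<noteq> 0}) \<and> closure {x. \<phi> x \<noteq> 0} \<subseteq> \<Omega>"

definition locally_integrable :: "(real^2) set \<Rightarrow> (real^2 \<Rightarrow> complex) \<Rightarrow> bool" where
  "locally_integrable \<Omega> u \<longleftrightarrow> (\<forall>K. compact K \<longrightarrow> K \<subseteq> \<Omega> \<longrightarrow> set_integrable lebesgue K u)"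

definition is_weak_gradient :: "(real^2) set \<Rightarrow> (real^2 \<Rightarrow> complex) \<Rightarrow> (real^2 \<Rightarrow> complex^2) \<Rightarrow> bool" where
  "is_weak_gradient \<Omega> u g \<longleftrightarrow>
     locally_integrable \<Omega> u \<and>
     (\<forall>i. locally_integrable \<Omega> (\<lambda>x. g x $ i)) \<and>
     (\<forall>\<phi>. test_function \<Omega> \<phi> \<longrightarrow>
        (\<forall>i. (LINT x:\<Omega>|lebesgue. u x * of_real (partial_deriv i \<phi> x))
             = - (LINT x:\<Omega>|lebesgue. g x $ i * of_real (\<phi> x))))"

(* A representative: the weak gradient is only determined almost everywhere. *)
definition weak_gradient :: "(real^2) set \<Rightarrow> (real^2 \<Rightarrow> complex) \<Rightarrow> real^2 \<Rightarrow> complex^2" where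
  "weak_gradient \<Omega> u = (SOME g. is_weak_gradient \<Omega> u g)"

definition square_integrable :: "(real^2) set \<Rightarrow> (real^2 \<Rightarrow> complex) \<Rightarrow> bool" where
  "square_integrable \<Omega> u \<longleftrightarrow>
     set_borel_measurable lebesgue \<Omega> u \<and> set_integrable lebesgue \<Omega> (\<lambda>x. (cmod (u x))\<^sup>2)"

(* Elements are functions, not classes modulo null sets. *)
definition H1 :: "(real^2) set \<Rightarrow> (real^2 \<Rightarrow> complex) set" where
  "H1 \<Omega> = {u. square_integrable \<Omega> u \<and>
     (\<exists>g. is_weak_gradient \<Omega> u g \<and> (\<forall>i. square_integrable \<Omega> (\<lambda>x. g x $ i)))}"

section \<open>Complex vectors and inner products\<close>

(* bilinear, without conjugation *)
definition cdot :: "complex^2 \<Rightarrow> complex^2 \<Rightarrow> complex" where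
  "cdot P Q = (\<Sum>i\<in>UNIV. P $ i * Q $ i)"

definition cnjv :: "complex^2 \<Rightarrow> complex^2" where
  "cnjv P = (\<chi> i. cnj (P $ i))"

definition cmat :: "real^2^2 \<Rightarrow> complex^2^2" where
  "cmat M = (\<chi> i j. of_real (M $ i $ j))"

definition inner_s :: "(real^2) set \<Rightarrow> (real^2 \<Rightarrow> complex) \<Rightarrow> (real^2 \<Rightarrow> complex) \<Rightarrow> complex" where
  "inner_s \<Omega> P Q = (LINT x:\<Omega>|lebesgue. P x * cnj (Q x))"

definition inner_v :: "(real^2) set \<Rightarrow> (real^2 \<Rightarrow> complex^2) \<Rightarrow> (real^2 \<Rightarrow> complex^2) \<Rightarrow> complex" where
  "inner_v \<Omega> P Q = (LINT x:\<Omega>|lebesgue. cdot (P x) (cnjv (Q x)))"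

section \<open>Polar coordinates\<close>

(* Functions of (r, theta) are written curried. All those used below are 2 pi-periodic in theta,
   so that the branch of the angle chosen by on_plane is immaterial. *)

definition on_plane :: "(real \<Rightarrow> real \<Rightarrow> 'c) \<Rightarrow> real^2 \<Rightarrow> 'c" where
  "on_plane f x = f (norm x) (Arg (Complex (x $ 1) (x $ 2)))"

definition d_r :: "(real \<Rightarrow> real \<Rightarrow> 'c::real_normed_vector) \<Rightarrow> real \<Rightarrow> real \<Rightarrow> 'c" where
  "d_r f r \<theta> = vector_derivative (\<lambda>s. f s \<theta>) (at r)"

definition d_th :: "(real \<Rightarrow> real \<Rightarrow> 'c::real_normed_vector) \<Rightarrow> real \<Rightarrow> real \<Rightarrow> 'c" where
  "d_th f r \<theta> = vector_derivative (\<lambda>s. f r s) (at \<theta>)"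

definition hat_grad :: "(real \<Rightarrow> real \<Rightarrow> complex) \<Rightarrow> real \<Rightarrow> real \<Rightarrow> complex^2" where
  "hat_grad f r \<theta> = vector [d_r f r \<theta>, of_real (1 / r) * d_th f r \<theta>]"

definition rot :: "real \<Rightarrow> real^2^2" where
  "rot \<theta> = vector [vector [cos \<theta>, - sin \<theta>], vector [sin \<theta>, cos \<theta>]]"

definition Omega2 :: "(real \<Rightarrow> real) \<Rightarrow> (real \<Rightarrow> real) \<Rightarrow> (real^2) set" where
  "Omega2 a b = {vector [r * cos \<theta>, r * sin \<theta>] | r \<theta>. a \<theta> < r \<and> r < b \<theta>}"

section \<open>The coordinate transform and its coefficient matrices\<close>

definition tau :: "(real \<Rightarrow> real) \<Rightarrow> real \<Rightarrow> real \<Rightarrow> real \<Rightarrow> real" where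
  "tau a \<tau>0 r \<theta> = a \<theta> * exp (\<tau>0 * (r - a \<theta>))"

(* Jacobian matrix, in Cartesian coordinates, of
   (r cos theta, r sin theta) \<mapsto> (tau cos theta, tau sin theta) *)
definition Jmat :: "(real \<Rightarrow> real) \<Rightarrow> real \<Rightarrow> real \<Rightarrow> real \<Rightarrow> real^2^2" where
  "Jmat a \<tau>0 r \<theta> =
     rot \<theta> ** vector [vector [d_r (tau a \<tau>0) r \<theta>, d_th (tau a \<tau>0) r \<theta> / r],
                      vector [0, tau a \<tau>0 r \<theta> / r]] ** transpose (rot \<theta>)"

definition Amat :: "(real \<Rightarrow> real) \<Rightarrow> real \<Rightarrow> real \<Rightarrow> real \<Rightarrow> real^2^2" where
  "Amat a \<tau>0 r \<theta> =
     det (Jmat a \<tau>0 r \<theta>) *\<^sub>R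
       (matrix_inv (Jmat a \<tau>0 r \<theta>) ** transpose (matrix_inv (Jmat a \<tau>0 r \<theta>)))"

definition Bmat :: "(real \<Rightarrow> real) \<Rightarrow> real \<Rightarrow> real \<Rightarrow> real \<Rightarrow> real^2^2" where
  "Bmat a \<tau>0 r \<theta> = transpose (rot \<theta>) ** Amat a \<tau>0 r \<theta> ** rot \<theta>"

section \<open>Wavenumbers, substitution factors and lower order coefficients\<close>

datatype wave = P | S

primrec wavenumber :: "real \<Rightarrow> real \<Rightarrow> real \<Rightarrow> real \<Rightarrow> wave \<Rightarrow> real" where
  "wavenumber \<omega> \<rho> lam \<mu> P = \<omega> * sqrt (\<rho> / (lam + 2 * \<mu>))"
| "wavenumber \<omega> \<rho> lam \<mu> S = \<omega> * sqrt (\<rho> / \<mu>)"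

definition w_fun :: "(real \<Rightarrow> real) \<Rightarrow> real \<Rightarrow> real \<Rightarrow> real \<Rightarrow> real \<Rightarrow> complex" where
  "w_fun a \<tau>0 k r \<theta> = exp (\<i> * of_real (k * (tau a \<tau>0 r \<theta> - a \<theta>)))"

(* r w^* / tau *)
definition rw_fun :: "(real \<Rightarrow> real) \<Rightarrow> real \<Rightarrow> real \<Rightarrow> real \<Rightarrow> real \<Rightarrow> complex" where
  "rw_fun a \<tau>0 k r \<theta> = of_real (r / tau a \<tau>0 r \<theta>) * cnj (w_fun a \<tau>0 k r \<theta>)"

definition p_vec :: "(real \<Rightarrow> real) \<Rightarrow> real \<Rightarrow> real \<Rightarrow> real \<Rightarrow> real \<Rightarrow> complex^2" where
  "p_vec a \<tau>0 k r \<theta> =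
     w_fun a \<tau>0 k r \<theta> *s (cmat (Bmat a \<tau>0 r \<theta>) *v hat_grad (rw_fun a \<tau>0 k) r \<theta>)"

definition q_vec :: "(real \<Rightarrow> real) \<Rightarrow> real \<Rightarrow> real \<Rightarrow> real \<Rightarrow> real \<Rightarrow> complex^2" where
  "q_vec a \<tau>0 k r \<theta> =
     rw_fun a \<tau>0 k r \<theta> *s (cmat (Bmat a \<tau>0 r \<theta>) *v hat_grad (w_fun a \<tau>0 k) r \<theta>)"

definition n_fun :: "(real \<Rightarrow> real) \<Rightarrow> real \<Rightarrow> real \<Rightarrow> real \<Rightarrow> real \<Rightarrow> complex" where
  "n_fun a \<tau>0 k r \<theta> =
     cdot (hat_grad (w_fun a \<tau>0 k) r \<theta>) (cmat (Bmat a \<tau>0 r \<theta>) *v hat_grad (rw_fun a \<tau>0 k) r \<theta>)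
     - of_real (k\<^sup>2 * d_r (tau a \<tau>0) r \<theta>)"

section \<open>The sesquilinear forms\<close>

definition form_A ::
  "(real \<Rightarrow> real) \<Rightarrow> (real \<Rightarrow> real) \<Rightarrow> real \<Rightarrow> (wave \<Rightarrow> real) \<Rightarrow>
   (wave \<Rightarrow> real^2 \<Rightarrow> complex) \<Rightarrow> (wave \<Rightarrow> real^2 \<Rightarrow> complex) \<Rightarrow> complex" where
  "form_A a b \<tau>0 k v \<zeta> =
     (\<Sum>t\<in>{P, S}.
        inner_v (Omega2 a b)
          (\<lambda>x. cmat (on_plane (Amat a \<tau>0) x) *v
                 weak_gradient (Omega2 a b) (\<lambda>y. on_plane (w_fun a \<tau>0 (k t)) y * v t y) x)
          (weak_gradient (Omega2 a b)
             (\<lambda>y. on_plane (\<lambda>r \<theta>. of_real (r / tau a \<tau>0 r \<theta>) * w_fun a \<tau>0 (k t) r \<theta>) y * \<zeta> t y))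
        - of_real ((k t)\<^sup>2) *
          inner_s (Omega2 a b) (\<lambda>x. of_real (on_plane (d_r (tau a \<tau>0)) x) * v t x) (\<zeta> t))"

definition form_At ::
  "(real \<Rightarrow> real) \<Rightarrow> (real \<Rightarrow> real) \<Rightarrow> real \<Rightarrow> real \<Rightarrow>
   (real^2 \<Rightarrow> complex) \<Rightarrow> (real^2 \<Rightarrow> complex) \<Rightarrow> complex" where
  "form_At a b \<tau>0 k v \<zeta> =
     inner_v (Omega2 a b)
       (\<lambda>x. of_real (on_plane (\<lambda>r \<theta>. r / tau a \<tau>0 r \<theta>) x) *s
              (cmat (on_plane (Amat a \<tau>0) x) *v weak_gradient (Omega2 a b) v x))
       (weak_gradient (Omega2 a b) \<zeta>)
   + inner_s (Omega2 a b)
       (\<lambda>x. cdot (on_plane (\<lambda>r \<theta>. cmat (rot \<theta>) *v p_vec a \<tau>0 k r \<theta>) x)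
                 (weak_gradient (Omega2 a b) v x))
       \<zeta>
   + inner_s (Omega2 a b)
       v
       (\<lambda>x. cdot (on_plane (\<lambda>r \<theta>. cmat (rot \<theta>) *v cnjv (q_vec a \<tau>0 k r \<theta>)) x)
                 (weak_gradient (Omega2 a b) \<zeta> x))
   + inner_s (Omega2 a b) (\<lambda>x. on_plane (n_fun a \<tau>0 k) x * v x) \<zeta>"

end

theory Submission
  imports Defs
begin

text \<open>
Both sides of the identity integrate over the layer. Formally the proof is one line: insert
\<open>\<nabla>(w v) = w \<nabla>v + v \<nabla>w\<close> and
\<open>\<nabla>(r w \<zeta> / \<tau>) = (r w / \<tau>) \<nabla>\<zeta> + \<zeta> \<nabla>(r w / \<tau>)\<close> into
\<open>A \<nabla>(w v) \<cdot> cnj \<nabla>(r w \<zeta> / \<tau>)\<close>, multiply out, and use \<open>w cnj w = 1\<close>, the symmetry of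
\<open>B\<close>, the relation \<open>A R = R B\<close> and the orthogonality of the rotation \<open>R\<close>. The four products are the four
terms of the new form (\<open>conjugated_product_identity\<close>, \<open>integrand_expansion\<close>). The explicit
coefficients follow from \<open>B = det M M^-1 M^-T\<close>, where \<open>M\<close> is the upper triangular factor of
the Jacobian matrix, by field arithmetic.

The analytic content is that \<open>v\<close> and \<open>\<zeta>\<close> are only weakly differentiable, and that a weak gradient is a
representative chosen arbitrarily from its class. Two facts are therefore needed on an open set of the plane.
Weak gradients are unique almost everywhere (\<open>is_weak_gradient_unique\<close>); this is the
fundamental lemma of the calculus of variations, obtained from smooth bumps that increase to the indicator of a box.
And the product rule holds for a multiplier that is merely \<open>C\<^sup>1\<close> (\<open>is_weak_gradient_mult\<close>), since
\<open>a\<close> is merely \<open>C\<^sup>1\<close>. In the product rule the multiplier is moved onto the test function,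
which then is no longer smooth; so the defining identity of a weak gradient is first extended to compactly
supported \<open>C\<^sup>1\<close> functions (\<open>is_weak_gradient_test_C1\<close>). The identity for
the \<open>i\<close>-th component involves only \<open>\<psi>\<close> and \<open>\<partial>\<^sub>i \<psi>\<close>, so a polynomial uniformly close to
\<open>\<partial>\<^sub>i \<psi>\<close> is integrated along the \<open>i\<close>-th axis to a polynomial close to \<open>\<psi>\<close>, and a smooth
cutoff restores the compact support.

Finally, the integral of the sum splits into the sum of the integrals because each coefficient is a continuous
function of \<open>(r, \<theta>)\<close> for \<open>r > 0\<close>, and the layer lies in a compact polar rectangle away from the origin, so the coefficients are bounded, while \<open>v\<close>, \<open>\<zeta>\<close> and their
gradients are square integrable. Periodicity also removes the jump of the principal argument from
all coefficients, because near every point other than the origin the angle has a differentiable branch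
(\<open>local_angle\<close>).
\<close>

section \<open>Smooth bumps on boxes\<close>

lemma partial_deriv_eqI:
  "(f has_derivative D) (at x) \<Longrightarrow> partial_deriv i f x = D (axis i 1)"
  unfolding partial_deriv_def by (metis frechet_derivative_at)

lemma differentiable_has_frechet:
  "f differentiable (at x) \<Longrightarrow> (f has_derivative frechet_derivative f (at x)) (at x)"
  by (simp add: frechet_derivative_works)

lemma partial_deriv_add:
  assumes "f differentiable (at x)" "g differentiable (at x)"
  shows "partial_deriv i (\<lambda>x. f x + g x) x = partial_deriv i f x + partial_deriv i g x"
  unfolding partial_deriv_def[of i f] partial_deriv_def[of i g]
  by (intro partial_deriv_eqI has_derivative_add differentiable_has_frechet assms)

lemma partial_deriv_mult:
  assumes "f differentiable (at x)" "g differentiable (at x)"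
  shows "partial_deriv i (\<lambda>x. f x * g x) x = f x * partial_deriv i g x + partial_deriv i f x * g x"
  unfolding partial_deriv_def[of i f] partial_deriv_def[of i g]
  by (intro partial_deriv_eqI has_derivative_mult differentiable_has_frechet assms)

lemma Ck_imp_continuous: "Ck n f \<Longrightarrow> continuous_on UNIV f"
  by (cases n) (auto simp: differentiable_on_def intro!: differentiable_imp_continuous_on)

lemma Ck_Suc_imp: "Ck (Suc n) f \<Longrightarrow> Ck n f"
proof (induction n arbitrary: f)
  case 0
  then show ?case using Ck_imp_continuous by fastforce
qed auto

lemma Ck_const: "Ck n (\<lambda>x. c)"
proof (induction n arbitrary: c)
  case (Suc n)
  have "partial_deriv i (\<lambda>x. c) = (\<lambda>x. 0)" for i
    by (rule ext) (rule partial_deriv_eqI, auto)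
  with Suc show ?case by simp
qed simp

lemma Ck_add: "Ck n f \<Longrightarrow> Ck n g \<Longrightarrow> Ck n (\<lambda>x. f x + g x)"
proof (induction n arbitrary: f g)
  case (Suc n)
  then have "partial_deriv i (\<lambda>x. f x + g x) = (\<lambda>x. partial_deriv i f x + partial_deriv i g x)" for i
    by (intro ext partial_deriv_add) auto
  with Suc show ?case by (simp add: differentiable_add)
qed (simp add: continuous_on_add)

lemma Ck_mult: "Ck n f \<Longrightarrow> Ck n g \<Longrightarrow> Ck n (\<lambda>x. f x * g x)"
proof (induction n arbitrary: f g)
  case (Suc n)
  then have eq: "partial_deriv i (\<lambda>x. f x * g x)
      = (\<lambda>x. f x * partial_deriv i g x + partial_deriv i f x * g x)" for i
    by (intro ext partial_deriv_mult) auto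
  have "Ck n f" "Ck n g" using Suc.prems by (auto intro: Ck_Suc_imp)
  then have "Ck n (partial_deriv i (\<lambda>x. f x * g x))" for i
    unfolding eq using Suc by (intro Ck_add Suc.IH) auto
  with Suc.prems show ?case by (simp add: differentiable_mult)
qed (simp add: continuous_on_mult)

lemma Ck_prod: "finite I \<Longrightarrow> (\<And>i. i \<in> I \<Longrightarrow> Ck n (f i)) \<Longrightarrow> Ck n (\<lambda>x. \<Prod>i\<in>I. f i x)"
  by (induction I rule: finite_induct) (auto intro: Ck_const Ck_mult)

text \<open>
For \<open>p = 1\<close> this is the usual function that vanishes to infinite order at \<open>0\<close>. The polynomial factor makes the
family closed under differentiation, so that smoothness becomes an induction over the order.
\<close>

definition flat :: "real poly \<Rightarrow> real \<Rightarrow> real" where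
  "flat p t = (if t > 0 then poly p (inverse t) * exp (- inverse t) else 0)"

lemma poly_exp_decay: "((\<lambda>s. poly p s * exp (- s)) \<longlongrightarrow> (0::real)) at_top"
proof -
  have "((\<lambda>s. \<Sum>i\<le>degree p. coeff p i * (s ^ i / exp s)) \<longlongrightarrow> (\<Sum>i\<le>degree p. coeff p i * 0)) at_top"
    by (intro tendsto_intros tendsto_power_div_exp_0)
  then show ?thesis
    by (simp add: poly_altdef exp_minus sum_distrib_right divide_inverse mult.assoc)
qed

lemma flat_tendsto_0: "(flat p \<longlongrightarrow> 0) (at 0)"
proof -
  have "((\<lambda>t. poly p (inverse t) * exp (- inverse t)) \<longlongrightarrow> 0) (at_right (0::real))"
    using filterlim_compose[OF poly_exp_decay filterlim_inverse_at_top_right] by simp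
  then have "(flat p \<longlongrightarrow> 0) (at_right 0)"
    by (rule Lim_transform_eventually)
      (auto simp: flat_def eventually_at_filter)
  moreover have "(flat p \<longlongrightarrow> 0) (at_left 0)"
    by (rule Lim_transform_eventually[OF tendsto_const]) (auto simp: flat_def eventually_at_filter)
  ultimately show ?thesis by (simp add: filterlim_at_split)
qed

text \<open>
From \<open>(p(1/t) exp(-1/t))' = (p - p')(1/t) / t\<^sup>2 \<cdot> exp(-1/t)\<close>.
\<close>

definition flat_deriv :: "real poly \<Rightarrow> real poly" where
  "flat_deriv p = [:0, 0, 1:] * (p - pderiv p)"

text \<open>
The only delicate point is \<open>t = 0\<close>. There the difference quotient of \<open>flat p\<close> is \<open>flat\<close> of the polynomial \<open>X p\<close>,
so continuity of the whole family at \<open>0\<close> already gives the derivative.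
\<close>

lemma flat_has_derivative: "(flat p has_real_derivative flat (flat_deriv p) t) (at t)"
proof (cases t "0::real" rule: linorder_cases)
  case less
  have "(flat p has_real_derivative 0) (at t)"
    by (rule has_field_derivative_transform_within_open[of "\<lambda>t. 0" _ _ "{..<0}"])
       (use less in \<open>auto simp: flat_def\<close>)
  with less show ?thesis by (simp add: flat_def)
next
  case equal
  have "((\<lambda>h. flat (pCons 0 p) h) \<longlongrightarrow> 0) (at 0)" by (rule flat_tendsto_0)
  then have "((\<lambda>h. (flat p (0 + h) - flat p 0) / h) \<longlongrightarrow> 0) (at 0)"
    by (rule Lim_transform_eventually) (auto simp: flat_def eventually_at_filter field_simps)
  then show ?thesis using equal by (simp add: DERIV_def flat_def)
next
  case greater
  have "((\<lambda>t. poly p (inverse t) * exp (- inverse t)) has_real_derivative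
      flat (flat_deriv p) t) (at t)"
    using greater
    by (auto intro!: derivative_eq_intros poly_DERIV[THEN DERIV_chain2]
        simp: flat_def flat_deriv_def field_simps power2_eq_square)
  then show ?thesis
    by (rule has_field_derivative_transform_within_open[of _ _ _ "{0<..}"])
       (use greater in \<open>auto simp: flat_def\<close>)
qed

lemma Ck_flat_coord: "Ck n (\<lambda>x. flat p (c * x $ i + d))"
proof (induction n arbitrary: p)
  case 0
  have "continuous_on UNIV (flat p)"
    using flat_has_derivative DERIV_isCont continuous_at_imp_continuous_on by blast
  then show ?case
    by (auto intro!: continuous_on_compose2[of UNIV "flat p"] continuous_intros)
next
  case (Suc n)
  have der: "((\<lambda>x. flat p (c * x $ i + d)) has_derivative
       (\<lambda>h. flat (flat_deriv p) (c * x $ i + d) * (c * h $ i))) (at x)" for x :: "real^2"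
    by (rule has_derivative_compose[where g = "flat p",
          OF _ flat_has_derivative[unfolded has_field_derivative_def]])
       (auto intro!: derivative_eq_intros bounded_linear.has_derivative[OF bounded_linear_vec_nth])
  have "partial_deriv j (\<lambda>x. flat p (c * x $ i + d))
      = (\<lambda>x. (c * axis j 1 $ i) * flat (flat_deriv p) (c * x $ i + d))" for j
    by (rule ext) (subst partial_deriv_eqI[OF der], simp)
  then show ?case
    using der Suc by (auto simp: differentiable_def intro!: Ck_mult Ck_const)
qed

text \<open>
The parameter \<open>s\<close> steepens the bump: \<open>flat 1 (s t)\<close> is the \<open>s\<close>-th root of \<open>flat 1 t\<close>, so the bumps tend to the
indicator of the open box as \<open>s\<close> grows, and all of them remain smooth.
\<close>

definition box_bump :: "real \<Rightarrow> real^2 \<Rightarrow> real^2 \<Rightarrow> real^2 \<Rightarrow> real" where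
  "box_bump s l u x = (\<Prod>i\<in>UNIV. flat 1 (s * (x $ i - l $ i)) * flat 1 (s * (u $ i - x $ i)))"

lemma flat_one_nonneg: "0 \<le> flat 1 t" and flat_one_le_one: "flat 1 t \<le> 1"
  and flat_one_pos_iff: "0 < flat 1 t \<longleftrightarrow> 0 < t"
  by (auto simp: flat_def)

lemma box_bump_nonneg: "0 \<le> box_bump s l u x"
  unfolding box_bump_def by (intro prod_nonneg) (simp add: flat_one_nonneg)

lemma box_bump_le_one: "box_bump s l u x \<le> 1"
  unfolding box_bump_def
  by (intro prod_le_1) (auto simp: flat_one_nonneg flat_one_le_one intro!: mult_le_one)

lemma box_bump_pos: "s > 0 \<Longrightarrow> x \<in> box l u \<Longrightarrow> box_bump s l u x > 0"
  unfolding box_bump_def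
  by (intro prod_pos) (auto simp: flat_one_pos_iff mem_box_cart)

lemma box_bump_eq_0: assumes "s > 0" "x \<notin> box l u" shows "box_bump s l u x = 0"
proof -
  obtain i where "\<not> (l $ i < x $ i \<and> x $ i < u $ i)" using assms by (auto simp: mem_box_cart)
  then have "flat 1 (s * (x $ i - l $ i)) * flat 1 (s * (u $ i - x $ i)) = 0"
    using \<open>s > 0\<close> by (auto simp: flat_def zero_less_mult_iff)
  then show ?thesis unfolding box_bump_def by (metis (no_types, lifting) UNIV_I finite prod_zero)
qed

lemma closure_support_subset:
  assumes "closed K" "\<And>x. x \<notin> K \<Longrightarrow> f x = (0::real)"
  shows "closure {x. f x \<noteq> 0} \<subseteq> K"
  using assms by (intro closure_minimal) auto

lemma zero_outside_closure_support:
  "x \<notin> closure {x. f x \<noteq> 0} \<Longrightarrow> f x = (0::real)"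
  by (metis (mono_tags, lifting) closure_subset mem_Collect_eq subsetD)

lemma test_functionI:
  assumes "\<And>n. Ck n f" "compact K" "K \<subseteq> \<Omega>" "\<And>x. x \<notin> K \<Longrightarrow> f x = 0"
  shows "test_function \<Omega> f"
proof -
  have sub: "closure {x. f x \<noteq> 0} \<subseteq> K"
    using assms by (intro closure_support_subset compact_imp_closed) auto
  then have "compact (closure {x. f x \<noteq> 0})"
    by (metis closed_closure assms(2) compact_Int_closed inf.absorb2)
  with sub assms show ?thesis unfolding test_function_def by blast
qed

lemma Ck_box_bump: "Ck n (box_bump s l u)"
proof -
  have "Ck n (\<lambda>x. \<Prod>i\<in>UNIV. flat 1 (s * x $ i + (- s * l $ i)) * flat 1 ((- s) * x $ i + s * u $ i))"
    by (intro Ck_prod Ck_mult Ck_flat_coord) auto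
  then show ?thesis unfolding box_bump_def[abs_def] by (simp add: algebra_simps)
qed

lemma test_function_box_bump:
  assumes "s > 0" "cbox l u \<subseteq> \<Omega>" shows "test_function \<Omega> (box_bump s l u)"
  by (rule test_functionI[OF Ck_box_bump compact_cbox assms(2)])
     (use assms(1) box_subset_cbox box_bump_eq_0 in blast)

lemma box_bump_tendsto_indicator:
  "(\<lambda>n. box_bump (real (Suc n)) l u x) \<longlonglongrightarrow> indicator (box l u) x"
proof (cases "x \<in> box l u")
  case True
  have lim: "(\<lambda>n. flat 1 (real (Suc n) * t)) \<longlonglongrightarrow> 1" if "t > 0" for t
  proof -
    have "(\<lambda>n. exp (- (inverse (real (Suc n)) * inverse t))) \<longlonglongrightarrow> exp (- (0 * inverse t))"
      by (intro tendsto_intros LIMSEQ_inverse_real_of_nat)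
    then show ?thesis using that by (simp add: flat_def zero_less_mult_iff)
  qed
  have "(\<lambda>n. box_bump (real (Suc n)) l u x) \<longlonglongrightarrow> (\<Prod>i\<in>(UNIV::2 set). 1 * 1)"
    unfolding box_bump_def
    by (intro tendsto_prod tendsto_mult lim) (use True in \<open>auto simp: mem_box_cart\<close>)
  with True show ?thesis by simp
next
  case False
  then show ?thesis by (simp add: box_bump_eq_0)
qed

lemma test_function_add:
  assumes "test_function \<Omega> f" "test_function \<Omega> g" shows "test_function \<Omega> (\<lambda>x. f x + g x)"
proof (rule test_functionI)
  show "compact (closure {x. f x \<noteq> 0} \<union> closure {x. g x \<noteq> 0})"
    "closure {x. f x \<noteq> 0} \<union> closure {x. g x \<noteq> 0} \<subseteq> \<Omega>"
    using assms unfolding test_function_def by (blast intro: compact_Un)+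
  show "f x + g x = 0" if "x \<notin> closure {x. f x \<noteq> 0} \<union> closure {x. g x \<noteq> 0}" for x
    using that zero_outside_closure_support[of x f] zero_outside_closure_support[of x g] by simp
qed (use assms in \<open>simp add: test_function_def Ck_add\<close>)

lemma test_function_mult_Ck:
  assumes "test_function \<Omega> f" "\<And>n. Ck n g" shows "test_function \<Omega> (\<lambda>x. f x * g x)"
proof (rule test_functionI)
  show "compact (closure {x. f x \<noteq> 0})" "closure {x. f x \<noteq> 0} \<subseteq> \<Omega>"
    using assms unfolding test_function_def by blast+
  show "f x * g x = 0" if "x \<notin> closure {x. f x \<noteq> 0}" for x
    using that zero_outside_closure_support[of x f] by simp
qed (use assms in \<open>simp add: test_function_def Ck_mult\<close>)

lemma test_functionE:
  assumes "test_function \<Omega> \<phi>"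
  obtains K where "compact K" "K \<subseteq> \<Omega>" "\<And>x. x \<notin> K \<Longrightarrow> \<phi> x = 0" "\<And>x i. x \<notin> K \<Longrightarrow> partial_deriv i \<phi> x = 0"
    "continuous_on UNIV \<phi>" "\<And>i. continuous_on UNIV (partial_deriv i \<phi>)" "\<And>x. \<phi> differentiable (at x)"
proof -
  define K where "K = closure {x. \<phi> x \<noteq> 0}"
  have K: "compact K" "K \<subseteq> \<Omega>" using assms by (auto simp: K_def test_function_def)
  have zero: "\<phi> x = 0" if "x \<notin> K" for x using that unfolding K_def by (rule zero_outside_closure_support)
  have Ck1: "Ck (Suc 0) \<phi>" using assms unfolding test_function_def by blast
  have p0: "partial_deriv i \<phi> x = 0" if "x \<notin> K" for i x
  proof -
    have "(\<phi> has_derivative (\<lambda>h. 0)) (at x)"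
      by (rule has_derivative_transform_within_open[OF has_derivative_const, of "- K" x 0])
         (use K zero that in \<open>auto simp: compact_imp_closed open_Compl\<close>)
    from partial_deriv_eqI[OF this] show ?thesis .
  qed
  show ?thesis
    by (rule that[OF K zero p0 Ck_imp_continuous[OF Ck1]]) (use Ck1 in simp_all)
qed

text \<open>
A sum of bumps over a finite cover of \<open>K\<close> by boxes. Positivity on \<open>K\<close> suffices for a cutoff that is used by
dividing a function supported in \<open>K\<close> by it and multiplying an approximation of the quotient by it again.
\<close>

lemma positive_test_function:
  assumes "open \<Omega>" "compact K" "K \<subseteq> \<Omega>"
  obtains \<kappa> where "test_function \<Omega> \<kappa>" "\<And>x. 0 \<le> \<kappa> x" "\<And>x. x \<in> K \<Longrightarrow> 0 < \<kappa> x"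
proof -
  define \<D> where "\<D> = {(l, u). cbox l u \<subseteq> \<Omega>}"
  have "K \<subseteq> (\<Union>d\<in>\<D>. box (fst d) (snd d))"
  proof
    fix x assume "x \<in> K"
    then obtain l u where "cbox l u \<subseteq> \<Omega>" "x \<in> box l u"
      using open_contains_cbox[OF assms(1)] assms(3) by (metis subsetD)
    then show "x \<in> (\<Union>d\<in>\<D>. box (fst d) (snd d))" unfolding \<D>_def by force
  qed
  then obtain \<D>' where D': "\<D>' \<subseteq> \<D>" "finite \<D>'" "K \<subseteq> (\<Union>d\<in>\<D>'. box (fst d) (snd d))"
    by (rule compactE_image[OF assms(2) open_box])
  define \<kappa> where "\<kappa> x = (\<Sum>d\<in>\<D>'. box_bump 1 (fst d) (snd d) x)" for x
  have zero: "test_function \<Omega> (\<lambda>x. 0)" by (rule test_functionI[of _ "{}"]) (auto intro: Ck_const)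
  have "test_function \<Omega> \<kappa>"
    unfolding \<kappa>_def using D'(2,1)
  proof (induction rule: finite_induct)
    case (insert d F)
    then have "test_function \<Omega> (box_bump 1 (fst d) (snd d))"
      by (intro test_function_box_bump) (auto simp: \<D>_def)
    from test_function_add[OF this insert.IH] insert show ?case by simp
  qed (simp add: zero)
  moreover have "0 \<le> \<kappa> x" for x unfolding \<kappa>_def by (intro sum_nonneg box_bump_nonneg)
  moreover have "0 < \<kappa> x" if "x \<in> K" for x
  proof -
    obtain d where "d \<in> \<D>'" "x \<in> box (fst d) (snd d)" using D'(3) \<open>x \<in> K\<close> by blast
    then show ?thesis unfolding \<kappa>_def
      by (intro sum_pos2[OF D'(2)] box_bump_pos box_bump_nonneg) auto
  qed
  ultimately show ?thesis using that by blast
qed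

section \<open>The fundamental lemma of the calculus of variations\<close>

lemma locally_integrableD:
  "locally_integrable \<Omega> u \<Longrightarrow> compact K \<Longrightarrow> K \<subseteq> \<Omega> \<Longrightarrow> set_integrable lebesgue K u"
  by (simp add: locally_integrable_def)

lemma set_integrable_lebesgue_mult_bounded:
  fixes u f :: "real^2 \<Rightarrow> complex"
  assumes u: "set_integrable lebesgue K u"
    and f: "set_borel_measurable lebesgue K f"
    and K: "K \<in> sets lebesgue"
    and bd: "\<And>x. x \<in> K \<Longrightarrow> cmod (f x) \<le> C"
  shows "set_integrable lebesgue K (\<lambda>x. f x * u x)"
proof (rule set_integrable_bound)
  show "set_integrable lebesgue K (\<lambda>x. complex_of_real C * u x)" using u by simp
  have "(\<lambda>x. indicator K x *\<^sub>R f x * (indicator K x *\<^sub>R u x)) \<in> borel_measurable lebesgue"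
    using u f unfolding set_borel_measurable_def set_integrable_def by (intro borel_measurable_times) auto
  then show "set_borel_measurable lebesgue K (\<lambda>x. f x * u x)"
    unfolding set_borel_measurable_def
    by (rule measurable_cong[THEN iffD1, rotated]) (auto simp: indicator_def)
  show "AE x in lebesgue. x \<in> K \<longrightarrow> cmod (f x * u x) \<le> cmod (complex_of_real C * u x)"
    using bd by (intro AE_I2 impI) (auto simp: norm_mult intro!: mult_right_mono order_trans[OF bd abs_ge_self])
qed

lemma set_borel_measurable_continuous_lebesgue:
  fixes f :: "real^2 \<Rightarrow> 'b::real_normed_vector"
  assumes "continuous_on K f" "K \<in> sets borel"
  shows "set_borel_measurable lebesgue K f"
  using borel_measurable_continuous_on_indicator[OF assms(2,1)]
  unfolding set_borel_measurable_def by (intro measurable_completion) simp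

lemma locally_integrable_mult_continuous:
  fixes u f :: "real^2 \<Rightarrow> complex"
  assumes "locally_integrable \<Omega> u" "continuous_on \<Omega> f"
  shows "locally_integrable \<Omega> (\<lambda>x. f x * u x)"
  unfolding locally_integrable_def
proof (intro allI impI)
  fix K assume K: "compact K" "K \<subseteq> \<Omega>"
  have cf: "continuous_on K f" using assms K continuous_on_subset by blast
  obtain C where "\<And>x. x \<in> K \<Longrightarrow> cmod (f x) \<le> C"
    using compact_imp_bounded[OF compact_continuous_image[OF cf K(1)]]
    by (auto simp: bounded_iff)
  then show "set_integrable lebesgue K (\<lambda>x. f x * u x)"
    using K assms cf
    by (intro set_integrable_lebesgue_mult_bounded set_borel_measurable_continuous_lebesgue)
       (auto intro: locally_integrableD borel_compact fmeasurableD lmeasurable_compact)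
qed

text \<open>
All integrals against test functions reduce to a compact set, where local integrability is integrability.
\<close>

lemma compact_support_integral:
  fixes u f :: "real^2 \<Rightarrow> complex"
  assumes "locally_integrable \<Omega> u" "compact K" "K \<subseteq> \<Omega>"
    and "continuous_on UNIV f" "\<And>x. x \<notin> K \<Longrightarrow> f x = 0"
  shows "set_integrable lebesgue \<Omega> (\<lambda>x. u x * f x)"
    and "set_integrable lebesgue K (\<lambda>x. u x * f x)"
    and "(LINT x:\<Omega>|lebesgue. u x * f x) = (LINT x:K|lebesgue. u x * f x)"
proof -
  have eq: "(\<lambda>x. indicator \<Omega> x *\<^sub>R (u x * f x)) = (\<lambda>x. indicator K x *\<^sub>R (u x * f x))"
    using assms(3,5) by (intro ext) (auto simp: indicator_def)
  have "locally_integrable UNIV (\<lambda>x. indicator K x *\<^sub>R u x)"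
    unfolding locally_integrable_def
  proof (intro allI impI)
    fix K' :: "(real^2) set" assume "compact K'"
    have "set_integrable lebesgue (K' \<inter> K) u"
      by (rule set_integrable_subset[OF locally_integrableD[OF assms(1,2,3)]])
         (use \<open>compact K'\<close> assms(2) in \<open>auto intro!: fmeasurableD lmeasurable_compact compact_Int\<close>)
    then show "set_integrable lebesgue K' (\<lambda>x. indicator K x *\<^sub>R u x)"
      by (simp add: set_integrable_def indicator_inter_arith)
  qed
  from locally_integrable_mult_continuous[OF this assms(4)]
  have "set_integrable lebesgue K (\<lambda>x. f x * (indicator K x *\<^sub>R u x))"
    using assms(2) locally_integrableD by blast
  moreover have "(\<lambda>x. indicator K x *\<^sub>R (f x * (indicator K x *\<^sub>R u x))) = (\<lambda>x. indicator K x *\<^sub>R (u x * f x))"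
    by (auto simp: indicator_def)
  ultimately show "set_integrable lebesgue \<Omega> (\<lambda>x. u x * f x)"
    "set_integrable lebesgue K (\<lambda>x. u x * f x)"
    "(LINT x:\<Omega>|lebesgue. u x * f x) = (LINT x:K|lebesgue. u x * f x)"
    by (simp_all add: set_integrable_def set_lebesgue_integral_def eq)
qed

text \<open>
Boxes form an intersection stable generator of the Borel sets, so the vanishing of the integral propagates to all
Borel sets, and from there to all Lebesgue sets, which differ from Borel sets by null sets.
\<close>

lemma AE_zero_if_box_integrals_zero:
  fixes f :: "real^2 \<Rightarrow> complex"
  assumes int: "integrable lebesgue f"
    and zero: "\<And>l u. (LINT x:box l u|lebesgue. f x) = 0"
  shows "AE x in lebesgue. f x = 0"
proof (rule sigma_finite_measure.density_zero[OF _ int])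
  show "sigma_finite_measure (lebesgue :: (real^2) measure)"
  proof
    obtain \<A> :: "(real^2) set set" where A: "countable \<A>" "\<A> \<subseteq> sets lborel" "\<Union>\<A> = UNIV"
        "\<forall>a\<in>\<A>. emeasure lborel a \<noteq> \<infinity>"
      using lborel.sigma_finite_countable by (elim exE conjE) (rule that, simp_all)
    then show "\<exists>\<A>. countable \<A> \<and> \<A> \<subseteq> sets (lebesgue :: (real^2) measure) \<and> \<Union>\<A> = space lebesgue
        \<and> (\<forall>a\<in>\<A>. emeasure lebesgue a \<noteq> \<infinity>)"
      by (intro exI[of _ \<A>]) (auto simp: subset_iff)
  qed
next
  have intA: "set_integrable lebesgue A f" if "A \<in> sets lebesgue" for A
    using set_integrable_subset[of lebesgue UNIV f A] int that by (simp add: set_integrable_def)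
  have UNIV0: "(LINT x:UNIV|lebesgue. f x) = 0"
  proof -
    have "(LINT x:(\<Union>i. box (- (real i *\<^sub>R One)) (real i *\<^sub>R One) :: (real^2) set)|lebesgue. f x) = 0"
    proof (rule LIMSEQ_unique[OF set_integral_cont_up tendsto_const[of 0, THEN Lim_transform_eventually]])
      show "incseq (\<lambda>i. box (- (real i *\<^sub>R One)) (real i *\<^sub>R One) :: (real^2) set)"
      proof (rule incseq_SucI)
        show "box (- (real i *\<^sub>R One)) (real i *\<^sub>R One)
           \<subseteq> (box (- (real (Suc i) *\<^sub>R One)) (real (Suc i) *\<^sub>R One) :: (real^2) set)" for i
          by (intro subset_box_imp) simp
      qed
    qed (auto simp: zero intro!: intA)
    then show ?thesis by (simp add: UN_box_eq_UNIV)
  qed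
  have borel0: "(LINT x:A|lebesgue. f x) = 0" if "A \<in> sets borel" for A
  proof -
    have gen: "A \<in> sigma_sets UNIV (range (\<lambda>(a, b). box a b))" using that by (simp add: borel_eq_box)
    have bs: "sigma_sets UNIV (range (\<lambda>(a, b). box a b)) = sets (borel :: (real^2) measure)"
      by (simp add: borel_eq_box)
    have st: "Int_stable (range (\<lambda>(a::real^2, b). box a b))"
      by (auto simp: Int_stable_def box_Int_box)
    have pow: "range (\<lambda>(a::real^2, b). box a b) \<subseteq> Pow UNIV" by simp
    show ?thesis
      using st pow gen
    proof (induction rule: sigma_sets_induct_disjoint)
      case (compl A)
      then have A: "A \<in> sets lebesgue" unfolding bs by simp
      have "(LINT x:A \<union> (UNIV - A)|lebesgue. f x) = (LINT x:A|lebesgue. f x) + (LINT x:UNIV - A|lebesgue. f x)"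
        using A by (intro set_integral_Un intA) auto
      then show ?case using compl UNIV0 by simp
    next
      case (union A)
      then have A: "A i \<in> sets lebesgue" for i unfolding bs by (simp add: subset_iff)
      have "(LINT x:(\<Union>i. A i)|lebesgue. f x) = (\<Sum>i. LINT x:A i|lebesgue. f x)"
        using A union by (intro lebesgue_integral_countable_add intA) (auto simp: disjoint_family_on_def)
      then show ?case using union by simp
    qed (use zero in \<open>auto simp: set_lebesgue_integral_def\<close>)
  qed
  fix A :: "(real^2) set" assume A: "A \<in> sets lebesgue"
  then obtain B N where B: "B \<in> sets borel" "negligible N" "B \<union> N = A"
    by (rule sets_lebesgue_almost_borel)
  have "(LINT x:A|lebesgue. f x) = (LINT x:B|lebesgue. f x)"
  proof (rule set_integral_cong_set)
    have "AE x in lebesgue. x \<notin> N" using B(2) by (intro AE_not_in) (simp add: negligible_iff_null_sets)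
    then show "AE x in lebesgue. x \<in> B \<longleftrightarrow> x \<in> A" by eventually_elim (use B(3) in blast)
    show "set_borel_measurable lebesgue B f" "set_borel_measurable lebesgue A f"
      using intA[of B] intA[OF A] B(1) by (auto simp: set_integrable_def set_borel_measurable_def)
  qed
  then show "(LINT x:A|lebesgue. f x) = 0" using borel0 B by simp
qed

text \<open>
By dominated convergence along steepening bumps the integral over every box inside \<open>\<Omega>\<close> vanishes, and \<open>\<Omega>\<close> is a
countable union of such boxes.
\<close>

lemma AE_zero_if_test_integrals_zero:
  fixes g :: "real^2 \<Rightarrow> complex"
  assumes "open \<Omega>" and g: "locally_integrable \<Omega> g"
    and zero: "\<And>\<phi>. test_function \<Omega> \<phi> \<Longrightarrow> (LINT x:\<Omega>|lebesgue. g x * of_real (\<phi> x)) = 0"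
  shows "AE x in lebesgue. x \<in> \<Omega> \<longrightarrow> g x = 0"
proof -
  have box0: "(LINT x:box l u|lebesgue. g x) = 0" if sub: "cbox l u \<subseteq> \<Omega>" for l u
  proof -
    have int: "set_integrable lebesgue (cbox l u) g" using g that by (auto intro: locally_integrableD)
    have lim: "(\<lambda>n. LINT x:\<Omega>|lebesgue. g x * of_real (box_bump (real (Suc n)) l u x)) \<longlonglongrightarrow> (LINT x:box l u|lebesgue. g x)"
      unfolding set_lebesgue_integral_def
    proof (rule integral_dominated_convergence)
      have intb: "set_integrable lebesgue (box l u) g"
        by (rule set_integrable_subset[OF int]) (auto simp: box_subset_cbox)
      then show "(\<lambda>x. indicator (box l u) x *\<^sub>R g x) \<in> borel_measurable lebesgue"
        by (auto simp: set_integrable_def)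
      show "integrable lebesgue (\<lambda>x. norm (indicator (box l u) x *\<^sub>R g x))"
        using intb unfolding set_integrable_def by (rule integrable_norm)
      show "(\<lambda>x. indicat_real \<Omega> x *\<^sub>R (g x * of_real (box_bump (real (Suc n)) l u x))) \<in> borel_measurable lebesgue" for n
      proof -
        have "set_integrable lebesgue \<Omega> (\<lambda>x. g x * of_real (box_bump (real (Suc n)) l u x))"
          by (rule compact_support_integral(1)[OF g compact_cbox sub])
            (use Ck_imp_continuous[OF Ck_box_bump] box_subset_cbox
              in \<open>blast intro!: continuous_intros, force intro: box_bump_eq_0\<close>)
        then show ?thesis by (auto simp: set_integrable_def)
      qed
      have sub': "box l u \<subseteq> \<Omega>" using sub box_subset_cbox by blast
      show "AE x in lebesgue. (\<lambda>n. indicat_real \<Omega> x *\<^sub>R (g x * of_real (box_bump (real (Suc n)) l u x)))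
           \<longlonglongrightarrow> indicat_real (box l u) x *\<^sub>R g x"
      proof (rule AE_I2)
        fix x
        have "(\<lambda>n. indicat_real \<Omega> x *\<^sub>R (g x * of_real (box_bump (real (Suc n)) l u x)))
           \<longlonglongrightarrow> indicat_real \<Omega> x *\<^sub>R (g x * of_real (indicator (box l u) x))"
          by (intro tendsto_intros box_bump_tendsto_indicator)
        moreover have "indicat_real \<Omega> x *\<^sub>R (g x * of_real (indicator (box l u) x)) = indicat_real (box l u) x *\<^sub>R g x"
          using sub' by (auto simp: indicator_def)
        ultimately show "(\<lambda>n. indicat_real \<Omega> x *\<^sub>R (g x * of_real (box_bump (real (Suc n)) l u x)))
           \<longlonglongrightarrow> indicat_real (box l u) x *\<^sub>R g x" by simp
      qed
      show "AE x in lebesgue. norm (indicat_real \<Omega> x *\<^sub>R (g x * of_real (box_bump (real (Suc n)) l u x)))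
         \<le> norm (indicat_real (box l u) x *\<^sub>R g x)" for n
        using sub' by (intro AE_I2) (auto simp: indicator_def norm_mult box_bump_eq_0 box_bump_nonneg box_bump_le_one
            intro!: mult_left_le)
    qed
    have "(LINT x:\<Omega>|lebesgue. g x * of_real (box_bump (real (Suc n)) l u x)) = 0" for n
      by (intro zero test_function_box_bump sub) simp
    then have "(\<lambda>n. LINT x:\<Omega>|lebesgue. g x * of_real (box_bump (real (Suc n)) l u x)) \<longlonglongrightarrow> 0"
      by (simp only: tendsto_const)
    from LIMSEQ_unique[OF lim this] show ?thesis .
  qed
  obtain \<D> where D: "countable \<D>" "\<And>B. B \<in> \<D> \<Longrightarrow> \<exists>l u. B = cbox l u" "\<Union>\<D> = \<Omega>"
    by (rule open_countable_Union_open_cbox[OF \<open>open \<Omega>\<close>]) (rule that)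
  have "AE x in lebesgue. x \<in> B \<longrightarrow> g x = 0" if "B \<in> \<D>" for B
  proof -
    obtain l u where B: "B = cbox l u" using D(2)[OF \<open>B \<in> \<D>\<close>] by blast
    have sub: "cbox l u \<subseteq> \<Omega>" using D(3) \<open>B \<in> \<D>\<close> unfolding B by blast
    have "AE x in lebesgue. indicator (box l u) x *\<^sub>R g x = 0"
    proof (rule AE_zero_if_box_integrals_zero)
      have "set_integrable lebesgue (cbox l u) g" using g sub by (auto intro: locally_integrableD)
      then have "set_integrable lebesgue (box l u) g"
        by (rule set_integrable_subset) (auto simp: box_subset_cbox)
      then show "integrable lebesgue (\<lambda>x. indicator (box l u) x *\<^sub>R g x)" by (simp add: set_integrable_def)
      fix l' u' :: "real^2"
      obtain l2 u2 where eq: "box l' u' \<inter> box l u = box l2 u2" using box_Int_box by blast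
      have "(LINT x:box l2 u2|lebesgue. g x) = 0"
      proof (cases "box l2 u2 = {}")
        case False
        have "box l2 u2 \<subseteq> cbox l u" using eq box_subset_cbox by blast
        then have "cbox l2 u2 \<subseteq> cbox l u"
          using closure_minimal[OF _ closed_cbox] closure_box[OF False] by metis
        then show ?thesis using box0 sub by blast
      qed (simp add: set_lebesgue_integral_def)
      moreover have "indicat_real (box l' u') x *\<^sub>R indicat_real (box l u) x *\<^sub>R g x
          = indicat_real (box l2 u2) x *\<^sub>R g x" for x
        unfolding eq[symmetric] by (simp split: split_indicator)
      ultimately show "(LINT x:box l' u'|lebesgue. indicator (box l u) x *\<^sub>R g x) = 0"
        unfolding set_lebesgue_integral_def by (simp only:)
    qed
    moreover have "AE x in lebesgue. x \<notin> cbox l u - box l u"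
    proof (rule AE_not_in)
      \<comment> \<open>the countable cover consists of closed boxes, the integrals are known for open ones\<close>
      show "cbox l u - box l u \<in> null_sets lebesgue"
        using negligible_frontier_interval[of l u] by (simp add: negligible_iff_null_sets)
    qed
    ultimately show ?thesis unfolding B by eventually_elim (auto simp: indicator_def split: if_splits)
  qed
  then have "AE x in lebesgue. \<forall>B\<in>\<D>. x \<in> B \<longrightarrow> g x = 0" by (subst AE_ball_countable) (use D in auto)
  then show ?thesis
  proof eventually_elim
    case (elim x)
    then show ?case unfolding D(3)[symmetric] by (simp only: Union_iff) blast
  qed
qed

section \<open>Testing a weak gradient against continuously differentiable functions\<close>

text \<open>
Polynomials in two variables, presented as sums of monomials: in this form an antiderivative along an axis is
visible, in contrast to the presentation of \<open>real_polynomial_function\<close> as an algebra generated by linear maps.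
\<close>

inductive bipoly :: "(real^2 \<Rightarrow> real) \<Rightarrow> bool" where
  monom: "bipoly (\<lambda>x. c * (x $ 1 ^ m * x $ 2 ^ n))"
| add: "bipoly f \<Longrightarrow> bipoly g \<Longrightarrow> bipoly (\<lambda>x. f x + g x)"

lemma bipoly_mult_monom: "bipoly f \<Longrightarrow> bipoly (\<lambda>x. f x * (c * (x $ 1 ^ m * x $ 2 ^ n)))"
proof (induction rule: bipoly.induct)
  case (monom d k l)
  have "(\<lambda>x::real^2. d * (x $ 1 ^ k * x $ 2 ^ l) * (c * (x $ 1 ^ m * x $ 2 ^ n)))
      = (\<lambda>x. (d * c) * (x $ 1 ^ (k + m) * x $ 2 ^ (l + n)))"
    by (simp add: power_add algebra_simps)
  then show ?case by (simp only: bipoly.monom)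
next
  case (add f g)
  then show ?case using bipoly.add by (simp add: distrib_right)
qed

lemma bipoly_mult: "bipoly g \<Longrightarrow> bipoly f \<Longrightarrow> bipoly (\<lambda>x. f x * g x)"
proof (induction rule: bipoly.induct)
  case (add g h)
  then show ?case using bipoly.add by (simp add: distrib_left)
qed (rule bipoly_mult_monom)

lemma bipoly_const: "bipoly (\<lambda>x. c)"
  using bipoly.monom[of c 0 0] by simp

lemma bipoly_coord: "bipoly (\<lambda>x. x $ i)"
  using bipoly.monom[of 1 1 0] bipoly.monom[of 1 0 1] exhaust_2[of i] by auto

lemma bipoly_if_real_polynomial_function: "real_polynomial_function f \<Longrightarrow> bipoly f"
proof (induction rule: real_polynomial_function.induct)
  case (linear f)
  then have "f x = f (axis 1 1) * x $ 1 + f (axis 2 1) * x $ 2" for x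
  proof -
    have "x = x $ 1 *\<^sub>R axis 1 1 + x $ 2 *\<^sub>R axis 2 1"
      by (simp add: vec_eq_iff forall_2 axis_def)
    then have "f x = f (x $ 1 *\<^sub>R axis 1 1 + x $ 2 *\<^sub>R axis 2 1)" by simp
    also have "\<dots> = f (axis 1 1) * x $ 1 + f (axis 2 1) * x $ 2"
      using bounded_linear.linear[OF linear] by (simp add: linear_add linear_scale)
    finally show ?thesis .
  qed
  then have "f = (\<lambda>x. f (axis 1 1) * x $ 1 + f (axis 2 1) * x $ 2)" by blast
  moreover have "bipoly (\<lambda>x. f (axis 1 1) * x $ 1 + f (axis 2 1) * x $ 2)"
    by (intro bipoly.add bipoly_mult bipoly_const bipoly_coord)
  ultimately show ?case by simp
qed (auto intro: bipoly_const bipoly.add bipoly_mult)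

lemma Ck_coord: "Ck n (\<lambda>x. x $ i)"
proof (cases n)
  case (Suc m)
  have der: "((\<lambda>x::real^2. x $ i) has_derivative (\<lambda>h. h $ i)) (at x)" for x
    by (rule bounded_linear.has_derivative[OF bounded_linear_vec_nth]) (rule has_derivative_ident)
  have "partial_deriv j (\<lambda>x. x $ i) = (\<lambda>x. axis j 1 $ i)" for j
    by (rule ext) (rule partial_deriv_eqI[OF der])
  with der Suc show ?thesis by (auto simp: differentiable_def intro: Ck_const)
qed (auto intro: continuous_intros)

lemma Ck_power: "Ck n f \<Longrightarrow> Ck n (\<lambda>x. f x ^ k)"
  by (induction k) (auto intro: Ck_const Ck_mult)

lemma Ck_bipoly: "bipoly f \<Longrightarrow> Ck n f"
  by (induction rule: bipoly.induct) (intro Ck_add Ck_mult Ck_const Ck_power Ck_coord)+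

definition update_coord :: "2 \<Rightarrow> real \<Rightarrow> real^2 \<Rightarrow> real^2" where
  "update_coord i t x = (\<chi> j. if j = i then t else x $ j)"

lemma bipoly_update_coord: "bipoly f \<Longrightarrow> bipoly (\<lambda>x. f (update_coord i t x))"
proof (induction rule: bipoly.induct)
  case (monom c m n)
  have "i = 1 \<or> i = 2" by (rule exhaust_2)
  then show ?case
    using bipoly.monom[of "c * t ^ m" 0 n] bipoly.monom[of "c * t ^ n" m 0]
    by (auto simp: update_coord_def algebra_simps)
qed (rule bipoly.add)

lemma update_coord_self: "update_coord i (x $ i) x = x"
  by (simp add: update_coord_def vec_eq_iff)

lemma continuous_on_update_coord: "continuous_on T (\<lambda>s. update_coord i s x)"
proof -
  have "continuous_on T (\<lambda>s. if j = i then s else x $ j)" for j by (cases "j = i") simp_all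
  then show ?thesis unfolding update_coord_def by (intro continuous_on_vec_lambda)
qed

lemma bipoly_antiderivative:
  assumes "bipoly f"
  obtains F where "bipoly F"
    "\<And>x t. ((\<lambda>s. F (update_coord i s x)) has_real_derivative f (update_coord i t x)) (at t)"
    "\<And>x. F (update_coord i t0 x) = 0"
proof -
  have "\<exists>F. bipoly F \<and> (\<forall>x t. ((\<lambda>s. F (update_coord i s x)) has_real_derivative f (update_coord i t x)) (at t))"
    using assms
  proof (induction rule: bipoly.induct)
    case (monom c m n)
    have i: "i = 1 \<or> i = 2" by (rule exhaust_2)
    define F where "F = (\<lambda>x::real^2. if i = 1 then c / real (Suc m) * (x $ 1 ^ Suc m * x $ 2 ^ n)
      else c / real (Suc n) * (x $ 1 ^ m * x $ 2 ^ Suc n))"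
    have "bipoly F" unfolding F_def
      by (cases "i = 1") (simp_all only: if_True if_False simp_thms bipoly.monom)
    moreover have "((\<lambda>s. F (update_coord i s x)) has_real_derivative
       c * (update_coord i t x $ 1 ^ m * update_coord i t x $ 2 ^ n)) (at t)" for x t
      using i unfolding F_def
      by (auto simp: update_coord_def simp del: power_Suc of_nat_Suc
           intro!: derivative_eq_intros)
    ultimately show ?case by blast
  next
    case (add f g)
    then obtain F G where "bipoly F" "bipoly G"
      "\<And>x t. ((\<lambda>s. F (update_coord i s x)) has_real_derivative f (update_coord i t x)) (at t)"
      "\<And>x t. ((\<lambda>s. G (update_coord i s x)) has_real_derivative g (update_coord i t x)) (at t)" by blast
    then show ?case
      by (intro exI[of _ "\<lambda>x. F x + G x"]) (auto intro: bipoly.add derivative_intros)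
  qed
  then obtain F where F: "bipoly F"
    "\<And>x t. ((\<lambda>s. F (update_coord i s x)) has_real_derivative f (update_coord i t x)) (at t)" by blast
  have uu: "update_coord i s (update_coord i t x) = update_coord i s x" for s t x
    by (simp add: update_coord_def vec_eq_iff)
  show ?thesis
  proof
    show "bipoly (\<lambda>x. F x + (-1) * F (update_coord i t0 x))"
      by (rule bipoly.add[OF F(1) bipoly_mult[OF bipoly_update_coord[OF F(1)] bipoly_const]])
    show "((\<lambda>s. F (update_coord i s x) + (-1) * F (update_coord i t0 (update_coord i s x)))
       has_real_derivative f (update_coord i t x)) (at t)" for x t
      unfolding uu using F(2) by (auto intro!: derivative_eq_intros)
  qed (simp add: uu)
qed

lemma has_derivative_along_axis:
  fixes f :: "real^2 \<Rightarrow> real"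
  assumes "f differentiable (at (update_coord i t x))"
  shows "((\<lambda>s. f (update_coord i s x)) has_real_derivative partial_deriv i f (update_coord i t x)) (at t)"
proof -
  have "((\<lambda>s. update_coord i s x) has_derivative (\<lambda>h. h *\<^sub>R axis i 1)) (at t)"
  proof -
    have "(\<lambda>s. update_coord i s x) = (\<lambda>s. update_coord i 0 x + s *\<^sub>R axis i 1)"
      by (auto simp: update_coord_def vec_eq_iff axis_def)
    then show ?thesis by (auto intro!: derivative_eq_intros)
  qed
  from has_derivative_compose[OF this differentiable_has_frechet[OF assms]]
  have "((\<lambda>s. f (update_coord i s x)) has_derivative
     (\<lambda>h. frechet_derivative f (at (update_coord i t x)) (h *\<^sub>R axis i 1))) (at t)" .
  moreover have "frechet_derivative f (at (update_coord i t x)) (h *\<^sub>R axis i 1)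
      = partial_deriv i f (update_coord i t x) * h" for h
    using linear_frechet_derivative[OF assms] by (simp add: partial_deriv_def linear_scale)
  ultimately show ?thesis by (simp add: has_field_derivative_def)
qed

text \<open>
The polynomial is an antiderivative of a Weierstrass approximation of \<open>D\<close> along the \<open>i\<close>-th axis. It is normalised
to vanish on the face \<open>x\<^sub>i = - M\<close> of a box that is so large that \<open>\<eta>\<close> vanishes there too; the mean value
inequality then carries the estimate from the derivative to the function.
\<close>

lemma C1_approximation:
  fixes \<eta> D :: "real^2 \<Rightarrow> real"
  assumes der: "\<And>x t. ((\<lambda>s. \<eta> (update_coord i s x)) has_real_derivative D (update_coord i t x)) (at t)"
    and cont: "continuous_on UNIV D"
    and zero: "\<And>x. L < norm x \<Longrightarrow> \<eta> x = 0"
    and "0 < \<epsilon>" "0 < L"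
  obtains Q where "bipoly Q" "\<And>x. norm x \<le> L \<Longrightarrow> \<bar>Q x - \<eta> x\<bar> \<le> \<epsilon>"
    "\<And>x. norm x \<le> L \<Longrightarrow> \<bar>partial_deriv i Q x - D x\<bar> \<le> \<epsilon>"
proof -
  define M where "M = 2 * L"
  define B :: "(real^2) set" where "B = {x. \<forall>j. \<bar>x $ j\<bar> \<le> M}"
  have "B = cbox (\<chi> j. - M) (\<chi> j. M)" by (auto simp: B_def mem_box_cart abs_le_iff minus_le_iff)
  then have "compact B" by simp
  \<comment> \<open>segments in the box have length at most \<open>2 * M\<close>\<close>
  define \<delta> where "\<delta> = min \<epsilon> (\<epsilon> / (2 * M))"
  have "0 < M" "0 < \<delta>" using assms by (auto simp: M_def \<delta>_def)
  obtain q where q: "real_polynomial_function q" "\<And>x. x \<in> B \<Longrightarrow> \<bar>D x - q x\<bar> < \<delta>"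
    by (rule Stone_Weierstrass_real_polynomial_function[OF \<open>compact B\<close> continuous_on_subset[OF cont] \<open>0 < \<delta>\<close>]) auto
  obtain Q where Q: "bipoly Q"
    "\<And>x t. ((\<lambda>s. Q (update_coord i s x)) has_real_derivative q (update_coord i t x)) (at t)"
    "\<And>x. Q (update_coord i (- M) x) = 0"
    using bipoly_antiderivative[OF bipoly_if_real_polynomial_function[OF q(1)]] by blast
  have inB: "x \<in> B" if "norm x \<le> L" for x :: "real^2"
  proof -
    have "\<bar>x $ j\<bar> \<le> M" for j using component_le_norm_cart[of x j] that \<open>0 < L\<close> unfolding M_def by linarith
    then show ?thesis by (simp add: B_def)
  qed
  show ?thesis
  proof
    fix x :: "real^2" assume x: "norm x \<le> L"
    have pd: "partial_deriv i Q x = q x"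
    proof -
      have "Q differentiable at x" using Ck_bipoly[OF Q(1), of "Suc 0"] by simp
      then have "((\<lambda>s. Q (update_coord i s x)) has_real_derivative partial_deriv i Q x) (at (x $ i))"
        using has_derivative_along_axis[of Q i "x $ i" x] by (simp add: update_coord_self)
      then show ?thesis using Q(2)[of x "x $ i"] DERIV_unique by (auto simp: update_coord_self)
    qed
    then show "\<bar>partial_deriv i Q x - D x\<bar> \<le> \<epsilon>"
      using q(2)[OF inB[OF x]] by (auto simp: \<delta>_def abs_minus_commute)
    have edge: "\<eta> (update_coord i (- M) x) = 0"
    proof (rule zero)
      have "\<bar>- M\<bar> \<le> norm (update_coord i (- M) x)"
        using component_le_norm_cart[of "update_coord i (- M) x" i] by (simp add: update_coord_def)
      then show "L < norm (update_coord i (- M) x)" using \<open>0 < L\<close> by (simp add: M_def)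
    qed
    have segB: "update_coord i t x \<in> B" if "t \<in> {- M..x $ i}" for t
    proof -
      have "\<bar>x $ j\<bar> \<le> M" for j using inB[OF x] by (simp add: B_def)
      moreover have "\<bar>t\<bar> \<le> M" using that calculation[of i] by auto
      ultimately show ?thesis unfolding B_def update_coord_def by simp
    qed
    have "norm ((\<lambda>s. Q (update_coord i s x) - \<eta> (update_coord i s x)) (x $ i)
              - (\<lambda>s. Q (update_coord i s x) - \<eta> (update_coord i s x)) (- M)) \<le> \<delta> * norm (x $ i - (- M))"
    proof (rule field_differentiable_bound[of "{- M..x $ i}" _ "\<lambda>t. q (update_coord i t x) - D (update_coord i t x)"])
      show "((\<lambda>s. Q (update_coord i s x) - \<eta> (update_coord i s x)) has_real_derivative
         q (update_coord i t x) - D (update_coord i t x)) (at t within {- M..x $ i})" for t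
        by (intro derivative_intros has_field_derivative_at_within[OF Q(2)] has_field_derivative_at_within[OF der])
      show "norm (q (update_coord i t x) - D (update_coord i t x)) \<le> \<delta>" if "t \<in> {- M..x $ i}" for t
        using q(2)[OF segB[OF that]] by (simp add: abs_minus_commute)
    qed (use inB[OF x] in \<open>auto simp: B_def abs_le_iff minus_le_iff\<close>)
    then have "\<bar>Q x - \<eta> x\<bar> \<le> \<delta> * \<bar>x $ i + M\<bar>"
      using edge Q(3) by (simp add: update_coord_self)
    also have "\<dots> \<le> \<epsilon> / (2 * M) * (2 * M)"
      using inB[OF x] \<open>0 < M\<close> \<open>0 < \<delta>\<close> \<open>0 < \<epsilon>\<close>
      by (intro mult_mono) (auto simp: \<delta>_def B_def abs_le_iff dest!: spec[of _ i])
    finally show "\<bar>Q x - \<eta> x\<bar> \<le> \<epsilon>" using \<open>0 < M\<close> by simp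
  qed (rule Q(1))
qed

text \<open>
Write \<open>\<psi> = \<kappa> \<eta>\<close> with a test function \<open>\<kappa>\<close> that is positive on the support of \<open>\<psi>\<close>, and replace \<open>\<eta>\<close> by a
polynomial \<open>Q\<close> that is close to it together with the \<open>i\<close>-th derivative. Then \<open>\<kappa> Q\<close> is a test function supported in the
fixed compact support of \<open>\<kappa>\<close>, so the error in the identity is controlled by the integrals of \<open>u\<close> and \<open>g\<close> over that set.
\<close>

lemma is_weak_gradient_test_C1:
  fixes \<psi> D :: "real^2 \<Rightarrow> real"
  assumes "open \<Omega>" and g: "is_weak_gradient \<Omega> u g"
    and K: "compact K" "K \<subseteq> \<Omega>" "\<And>x. x \<notin> K \<Longrightarrow> \<psi> x = 0"
    and cont: "continuous_on UNIV \<psi>" "continuous_on UNIV D"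
    and der: "\<And>x t. ((\<lambda>s. \<psi> (update_coord i s x)) has_real_derivative D (update_coord i t x)) (at t)"
  shows "(LINT x:\<Omega>|lebesgue. u x * of_real (D x)) = - (LINT x:\<Omega>|lebesgue. g x $ i * of_real (\<psi> x))"
proof -
  have D0: "D x = 0" if "x \<notin> K" for x
  proof -
    have "open (- K)" using K(1) by (simp add: compact_imp_closed open_Compl)
    then have "open ((\<lambda>s. update_coord i s x) -` (- K))"
      using continuous_on_update_coord by (rule open_vimage)
    then have "((\<lambda>s. \<psi> (update_coord i s x)) has_real_derivative 0) (at (x $ i))"
      by (rule has_field_derivative_transform_within_open[OF DERIV_const])
         (use that K(3) in \<open>auto simp: update_coord_self\<close>)
    from DERIV_unique[OF der this] show ?thesis by (simp add: update_coord_self)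
  qed
  obtain \<kappa> where \<kappa>: "test_function \<Omega> \<kappa>" "\<And>x. 0 \<le> \<kappa> x" "\<And>x. x \<in> K \<Longrightarrow> 0 < \<kappa> x"
    using positive_test_function[OF \<open>open \<Omega>\<close> K(1,2)] by blast
  obtain K' where K': "compact K'" "K' \<subseteq> \<Omega>" "\<And>x. x \<notin> K' \<Longrightarrow> \<kappa> x = 0"
    and p0: "\<And>x i. x \<notin> K' \<Longrightarrow> partial_deriv i \<kappa> x = 0"
    and \<kappa>cont: "continuous_on UNIV \<kappa>" and pcont: "\<And>i. continuous_on UNIV (partial_deriv i \<kappa>)"
    and \<kappa>diff: "\<And>x. \<kappa> differentiable (at x)"
    using test_functionE[OF \<kappa>(1)] by blast
  have KK': "K \<subseteq> K'" using \<kappa>(3) K'(3) by force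
  define \<eta> where "\<eta> x = \<psi> x / \<kappa> x" for x
  \<comment> \<open>the \<open>i\<close>-th partial derivative of \<open>\<eta>\<close>\<close>
  define E where "E x = (if \<kappa> x = 0 then 0 else (D x * \<kappa> x - \<psi> x * partial_deriv i \<kappa> x) / (\<kappa> x)\<^sup>2)" for x
  have \<psi>\<eta>: "\<psi> x = \<kappa> x * \<eta> x" for x using K(3)[of x] \<kappa>(3)[of x] by (cases "x \<in> K") (simp_all add: \<eta>_def)
  have DE: "D x = \<kappa> x * E x + partial_deriv i \<kappa> x * \<eta> x" for x
    using D0[of x] \<kappa>(3)[of x] K(3)[of x]
    by (cases "x \<in> K") (simp_all add: \<eta>_def E_def field_simps power2_eq_square)
  have derE: "((\<lambda>s. \<eta> (update_coord i s x)) has_real_derivative E (update_coord i t x)) (at t)" for x t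
  proof (cases "update_coord i t x \<in> K")
    case True
    then have "\<kappa> (update_coord i t x) \<noteq> 0" using \<kappa>(3) by force
    then show ?thesis unfolding \<eta>_def E_def
      using DERIV_divide[OF der[of x t] has_derivative_along_axis[of \<kappa> i t x, OF \<kappa>diff]]
      by (simp add: power2_eq_square mult.commute)
  next
    case False
    have "open ((\<lambda>s. update_coord i s x) -` (- K))"
      using K(1) by (intro open_vimage continuous_on_update_coord) (simp add: compact_imp_closed open_Compl)
    then have "((\<lambda>s. \<eta> (update_coord i s x)) has_real_derivative 0) (at t)"
      by (rule has_field_derivative_transform_within_open[OF DERIV_const])
         (use False K(3) in \<open>auto simp: \<eta>_def\<close>)
    moreover have "E (update_coord i t x) = 0" using D0[OF False] K(3)[OF False] by (simp add: E_def)
    ultimately show ?thesis by simp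
  qed
  have contE: "continuous_on UNIV E"
  proof -
    define U where "U = {x. \<kappa> x \<noteq> 0}"
    have U: "open U" "open (- K)"
      using K(1) open_Collect_neq[OF \<kappa>cont continuous_on_const]
      by (auto simp: U_def compact_imp_closed open_Compl)
    have "\<kappa> x \<noteq> 0" if "x \<in> K" for x using \<kappa>(3)[OF that] by simp
    then have U3: "U \<union> - K = UNIV" by (auto simp: U_def)
    have "continuous_on U (\<lambda>x. (D x * \<kappa> x - \<psi> x * partial_deriv i \<kappa> x) / (\<kappa> x)\<^sup>2)"
      using cont \<kappa>cont pcont
      by (intro continuous_intros) (auto simp: U_def intro: continuous_on_subset)
    then have "continuous_on U E" by (rule continuous_on_eq) (simp add: E_def U_def)
    moreover have "continuous_on (- K) E"
      by (rule continuous_on_eq[OF continuous_on_const[of _ 0]]) (use D0 K(3) in \<open>simp add: E_def\<close>)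
    ultimately show ?thesis using continuous_on_open_Un[OF U(1,2)] U3 by metis
  qed
  obtain L where L: "0 < L" "\<And>x. x \<in> K' \<Longrightarrow> norm x \<le> L"
    using compact_imp_bounded[OF K'(1)] unfolding bounded_pos by blast
  have zero: "\<eta> x = 0" if "L < norm x" for x
    using that L(2) KK' K(3)[of x] by (force simp: \<eta>_def)
  have lu: "locally_integrable \<Omega> u" and lg: "locally_integrable \<Omega> (\<lambda>x. g x $ i)"
    using g by (auto simp: is_weak_gradient_def)
  obtain C where C: "0 < C" "\<And>x. x \<in> K' \<Longrightarrow> \<bar>\<kappa> x\<bar> \<le> C" "\<And>x. x \<in> K' \<Longrightarrow> \<bar>partial_deriv i \<kappa> x\<bar> \<le> C"
  proof -
    obtain C1 where "\<And>x. x \<in> K' \<Longrightarrow> \<bar>\<kappa> x\<bar> \<le> C1"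
      using compact_imp_bounded[OF compact_continuous_image[OF continuous_on_subset[OF \<kappa>cont] K'(1)]]
      by (auto simp: bounded_iff)
    moreover obtain C2 where "\<And>x. x \<in> K' \<Longrightarrow> \<bar>partial_deriv i \<kappa> x\<bar> \<le> C2"
      using compact_imp_bounded[OF compact_continuous_image[OF continuous_on_subset[OF pcont[of i]] K'(1)]]
      by (auto simp: bounded_iff)
    ultimately show ?thesis
      by (intro that[of "max 1 (max C1 C2)"]) (auto simp: le_max_iff_disj)
  qed
  have iu: "set_integrable lebesgue K' u" and ig: "set_integrable lebesgue K' (\<lambda>x. g x $ i)"
    using lu lg K' by (auto intro: locally_integrableD)
  define I where "I = 2 * C * (LINT x:K'|lebesgue. cmod (u x)) + C * (LINT x:K'|lebesgue. cmod (g x $ i))"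
  define A where "A = (LINT x:\<Omega>|lebesgue. u x * of_real (D x)) + (LINT x:\<Omega>|lebesgue. g x $ i * of_real (\<psi> x))"
  \<comment> \<open>the defect \<open>A\<close> of the identity is of order \<open>\<epsilon>\<close> because it vanishes for the test function \<open>\<phi>\<close>\<close>
  have bound: "cmod A \<le> \<epsilon> * I" if "0 < \<epsilon>" for \<epsilon>
  proof -
    obtain Q where Q: "bipoly Q" "\<And>x. norm x \<le> L \<Longrightarrow> \<bar>Q x - \<eta> x\<bar> \<le> \<epsilon>"
      "\<And>x. norm x \<le> L \<Longrightarrow> \<bar>partial_deriv i Q x - E x\<bar> \<le> \<epsilon>"
      using C1_approximation[OF derE contE zero \<open>0 < \<epsilon>\<close> L(1)] by blast
    define \<phi> where "\<phi> x = \<kappa> x * Q x" for x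
    have \<phi>: "test_function \<Omega> \<phi>" unfolding \<phi>_def
      by (intro test_function_mult_Ck \<kappa>(1) Ck_bipoly Q(1))
    have Qdiff: "Q differentiable (at x)" and Qcont: "continuous_on UNIV Q"
      and Qpcont: "continuous_on UNIV (partial_deriv i Q)" for x
      using Ck_bipoly[OF Q(1), of "Suc 0"] Ck_bipoly[OF Q(1), of 0] by auto
    have p\<phi>: "partial_deriv i \<phi> x = \<kappa> x * partial_deriv i Q x + partial_deriv i \<kappa> x * Q x" for x
      unfolding \<phi>_def by (rule partial_deriv_mult[OF \<kappa>diff Qdiff])
    have p\<phi>cont: "continuous_on UNIV (partial_deriv i \<phi>)" and \<phi>cont: "continuous_on UNIV \<phi>"
      unfolding p\<phi>[abs_def] \<phi>_def by (intro continuous_intros \<kappa>cont pcont Qcont Qpcont)+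
    have restrict: "(LINT x:\<Omega>|lebesgue. y x * of_real (h x)) = (LINT x:K'|lebesgue. y x * of_real (h x))"
      "set_integrable lebesgue K' (\<lambda>x. y x * of_real (h x))"
      if "locally_integrable \<Omega> y" "continuous_on UNIV h" "\<And>x. x \<notin> K' \<Longrightarrow> h x = 0"
      for y :: "real^2 \<Rightarrow> complex" and h :: "real^2 \<Rightarrow> real"
      using that by (intro compact_support_integral K' continuous_intros; simp)+
    have "x \<notin> K" if "x \<notin> K'" for x using KK' that by blast
    then have out: "x \<notin> K' \<Longrightarrow> D x = 0" "x \<notin> K' \<Longrightarrow> \<psi> x = 0"
        "x \<notin> K' \<Longrightarrow> partial_deriv i \<phi> x = 0" "x \<notin> K' \<Longrightarrow> \<phi> x = 0" for x
      using D0[of x] K(3)[of x] p0[of x] K'(3)[of x] unfolding p\<phi> \<phi>_def by auto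
    note int = restrict[OF lu cont(2) out(1)] restrict[OF lg cont(1) out(2)]
      restrict[OF lu p\<phi>cont out(3)] restrict[OF lg \<phi>cont out(4)]
    have "(LINT x:\<Omega>|lebesgue. u x * of_real (partial_deriv i \<phi> x)) = - (LINT x:\<Omega>|lebesgue. g x $ i * of_real (\<phi> x))"
      using g \<phi> unfolding is_weak_gradient_def by blast
    then have "A = ((LINT x:K'|lebesgue. u x * of_real (D x)) - (LINT x:K'|lebesgue. u x * of_real (partial_deriv i \<phi> x)))
        + ((LINT x:K'|lebesgue. g x $ i * of_real (\<psi> x)) - (LINT x:K'|lebesgue. g x $ i * of_real (\<phi> x)))"
      unfolding A_def using int by simp
    also have "\<dots> = (LINT x:K'|lebesgue. u x * of_real (D x) - u x * of_real (partial_deriv i \<phi> x))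
        + (LINT x:K'|lebesgue. g x $ i * of_real (\<psi> x) - g x $ i * of_real (\<phi> x))"
      by (simp add: set_integral_diff int)
    finally have Aeq: "A = \<dots>" .
    have b1: "cmod (LINT x:K'|lebesgue. u x * of_real (D x) - u x * of_real (partial_deriv i \<phi> x))
        \<le> (LINT x:K'|lebesgue. 2 * C * \<epsilon> * cmod (u x))"
    proof (rule order_trans[OF set_integral_norm_bound set_integral_mono])
      show "cmod (u x * of_real (D x) - u x * of_real (partial_deriv i \<phi> x)) \<le> 2 * C * \<epsilon> * cmod (u x)" if "x \<in> K'" for x
      proof -
        have "\<bar>D x - partial_deriv i \<phi> x\<bar> = \<bar>\<kappa> x * (E x - partial_deriv i Q x) + partial_deriv i \<kappa> x * (\<eta> x - Q x)\<bar>"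
          unfolding DE[of x] p\<phi> by (simp add: algebra_simps)
        also have "\<dots> \<le> \<bar>\<kappa> x\<bar> * \<bar>E x - partial_deriv i Q x\<bar> + \<bar>partial_deriv i \<kappa> x\<bar> * \<bar>\<eta> x - Q x\<bar>"
          by (metis abs_mult abs_triangle_ineq)
        also have "\<dots> \<le> C * \<epsilon> + C * \<epsilon>"
          using C that Q(2,3)[OF L(2)[OF that]]
          by (intro add_mono mult_mono) (auto simp: abs_minus_commute less_imp_le)
        finally have "\<bar>D x - partial_deriv i \<phi> x\<bar> \<le> 2 * C * \<epsilon>" by simp
        moreover have "cmod (u x * of_real (D x) - u x * of_real (partial_deriv i \<phi> x)) = cmod (u x) * \<bar>D x - partial_deriv i \<phi> x\<bar>"
          by (metis norm_mult norm_of_real of_real_diff right_diff_distrib)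
        ultimately show ?thesis by (simp add: mult.commute mult_left_mono)
      qed
    qed (use int iu in \<open>auto intro!: set_integral_diff set_integrable_norm\<close>)
    have b2: "cmod (LINT x:K'|lebesgue. g x $ i * of_real (\<psi> x) - g x $ i * of_real (\<phi> x))
        \<le> (LINT x:K'|lebesgue. C * \<epsilon> * cmod (g x $ i))"
    proof (rule order_trans[OF set_integral_norm_bound set_integral_mono])
      show "cmod (g x $ i * of_real (\<psi> x) - g x $ i * of_real (\<phi> x)) \<le> C * \<epsilon> * cmod (g x $ i)" if "x \<in> K'" for x
      proof -
        have "\<bar>\<psi> x - \<phi> x\<bar> = \<bar>\<kappa> x\<bar> * \<bar>\<eta> x - Q x\<bar>"
          unfolding \<psi>\<eta>[of x] \<phi>_def by (simp add: abs_mult[symmetric] right_diff_distrib)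
        also have "\<dots> \<le> C * \<epsilon>"
          using C that Q(2)[OF L(2)[OF that]] by (intro mult_mono) (auto simp: abs_minus_commute less_imp_le)
        finally have "\<bar>\<psi> x - \<phi> x\<bar> \<le> C * \<epsilon>" .
        moreover have "cmod (g x $ i * of_real (\<psi> x) - g x $ i * of_real (\<phi> x)) = cmod (g x $ i) * \<bar>\<psi> x - \<phi> x\<bar>"
          by (metis norm_mult norm_of_real of_real_diff right_diff_distrib)
        ultimately show ?thesis by (metis mult.commute mult_left_mono norm_ge_zero)
      qed
    qed (use int ig in \<open>auto intro!: set_integral_diff set_integrable_norm\<close>)
    have "cmod A \<le> (LINT x:K'|lebesgue. 2 * C * \<epsilon> * cmod (u x)) + (LINT x:K'|lebesgue. C * \<epsilon> * cmod (g x $ i))"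
      unfolding Aeq using b1 b2 norm_triangle_mono by blast
    then show ?thesis by (simp add: I_def algebra_simps)
  qed
  have "cmod A \<le> 0"
  proof (rule field_le_epsilon)
    fix e :: real assume "0 < e"
    have "0 \<le> I" unfolding I_def using C(1)
      by (intro add_nonneg_nonneg mult_nonneg_nonneg)
         (auto simp: set_lebesgue_integral_def intro!: integral_nonneg_AE)
    then have "e / (I + 1) * I \<le> e" using \<open>0 < e\<close> by (simp add: field_simps)
    then show "cmod A \<le> 0 + e" using bound[of "e / (I + 1)"] \<open>0 < e\<close> \<open>0 \<le> I\<close> by fastforce
  qed
  then show ?thesis by (simp add: A_def eq_neg_iff_add_eq_0)
qed

section \<open>Uniqueness of weak gradients and the product rule\<close>

lemma continuous_on_UNIV_if_compact_support:
  fixes f :: "real^2 \<Rightarrow> 'b::real_normed_vector"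
  assumes "open \<Omega>" "compact K" "K \<subseteq> \<Omega>" "continuous_on \<Omega> f" "\<And>x. x \<notin> K \<Longrightarrow> f x = 0"
  shows "continuous_on UNIV f"
proof -
  have "open (- K)" using assms(2) by (simp add: compact_imp_closed open_Compl)
  moreover have "continuous_on (- K) f"
    by (rule continuous_on_eq[OF continuous_on_const[of _ 0]]) (simp add: assms(5))
  moreover have "\<Omega> \<union> - K = UNIV" using assms(3) by blast
  ultimately show ?thesis using continuous_on_open_Un[OF assms(1) _ assms(4)] by metis
qed

lemma is_weak_gradient_unique:
  assumes "open \<Omega>" "is_weak_gradient \<Omega> u g" "is_weak_gradient \<Omega> u h"
  shows "AE x in lebesgue. x \<in> \<Omega> \<longrightarrow> g x = h x"
proof -
  have "AE x in lebesgue. x \<in> \<Omega> \<longrightarrow> g x $ i - h x $ i = 0" for i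
  proof (rule AE_zero_if_test_integrals_zero[OF \<open>open \<Omega>\<close>])
    have li: "locally_integrable \<Omega> (\<lambda>x. g x $ i)" "locally_integrable \<Omega> (\<lambda>x. h x $ i)"
      using assms by (auto simp: is_weak_gradient_def)
    then show "locally_integrable \<Omega> (\<lambda>x. g x $ i - h x $ i)"
      unfolding locally_integrable_def by (intro allI impI set_integral_diff) blast+
    fix \<phi> assume \<phi>: "test_function \<Omega> \<phi>"
    obtain K where K: "compact K" "K \<subseteq> \<Omega>" "\<And>x. x \<notin> K \<Longrightarrow> \<phi> x = 0" "continuous_on UNIV \<phi>"
      using test_functionE[OF \<phi>] by metis
    have c: "continuous_on UNIV (\<lambda>x. complex_of_real (\<phi> x))" by (intro continuous_intros K)
    have int: "set_integrable lebesgue \<Omega> (\<lambda>x. g x $ i * of_real (\<phi> x))"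
         "set_integrable lebesgue \<Omega> (\<lambda>x. h x $ i * of_real (\<phi> x))"
      by (rule compact_support_integral(1)[OF li(1) K(1,2) c], simp add: K,
          rule compact_support_integral(1)[OF li(2) K(1,2) c], simp add: K)
    have "(LINT x:\<Omega>|lebesgue. (g x $ i - h x $ i) * of_real (\<phi> x))
       = (LINT x:\<Omega>|lebesgue. g x $ i * of_real (\<phi> x)) - (LINT x:\<Omega>|lebesgue. h x $ i * of_real (\<phi> x))"
      using int by (simp add: left_diff_distrib set_integral_diff)
    also have "\<dots> = 0"
    proof -
      have "(LINT x:\<Omega>|lebesgue. u x * of_real (partial_deriv i \<phi> x))
          = - (LINT x:\<Omega>|lebesgue. w x $ i * of_real (\<phi> x))" if "is_weak_gradient \<Omega> u w" for w
        using that \<phi> unfolding is_weak_gradient_def by blast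
      from this[OF assms(2)] this[OF assms(3)] show ?thesis by simp
    qed
    finally show "(LINT x:\<Omega>|lebesgue. (g x $ i - h x $ i) * of_real (\<phi> x)) = 0" .
  qed
  from this[of 1] this[of 2] show ?thesis
    by eventually_elim (auto simp: vec_eq_iff forall_2)
qed

lemma weak_gradient_is: "is_weak_gradient \<Omega> u g \<Longrightarrow> is_weak_gradient \<Omega> u (weak_gradient \<Omega> u)"
  unfolding weak_gradient_def by (rule someI[of "is_weak_gradient \<Omega> u"])

lemma weak_gradient_AE_eq:
  "open \<Omega> \<Longrightarrow> is_weak_gradient \<Omega> u g \<Longrightarrow> AE x in lebesgue. x \<in> \<Omega> \<longrightarrow> weak_gradient \<Omega> u x = g x"
  by (rule is_weak_gradient_unique[OF _ weak_gradient_is])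

text \<open>
Testing \<open>m u\<close> with \<open>\<phi>\<close> is testing \<open>u\<close> with \<open>m \<phi>\<close>, a \<open>C\<^sup>1\<close> function with compact support. As test functions are
real, this is done for the real and the imaginary part of \<open>m\<close> separately.
\<close>

lemma is_weak_gradient_mult:
  fixes m :: "real^2 \<Rightarrow> complex" and G :: "real^2 \<Rightarrow> complex^2"
  assumes "open \<Omega>" and g: "is_weak_gradient \<Omega> u g"
    and der: "\<And>x. x \<in> \<Omega> \<Longrightarrow> (m has_derivative (\<lambda>h. \<Sum>j\<in>UNIV. of_real (h $ j) * G x $ j)) (at x)"
    and contG: "\<And>j. continuous_on \<Omega> (\<lambda>x. G x $ j)"
  shows "is_weak_gradient \<Omega> (\<lambda>x. m x * u x) (\<lambda>x. m x *s g x + u x *s G x)"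
  unfolding is_weak_gradient_def
proof (intro conjI allI impI)
  have lu: "locally_integrable \<Omega> u" and lg: "locally_integrable \<Omega> (\<lambda>x. g x $ j)" for j
    using g by (auto simp: is_weak_gradient_def)
  have contm: "continuous_on \<Omega> m"
    using der has_derivative_continuous by (blast intro: continuous_at_imp_continuous_on)
  show "locally_integrable \<Omega> (\<lambda>x. m x * u x)"
    by (rule locally_integrable_mult_continuous[OF lu contm])
  show "locally_integrable \<Omega> (\<lambda>x. (m x *s g x + u x *s G x) $ j)" for j
    using locally_integrable_mult_continuous[OF lg[of j] contm]
      locally_integrable_mult_continuous[OF lu contG[of j]]
    unfolding locally_integrable_def by (auto simp: mult.commute intro!: set_integral_add)
  fix \<phi> i assume \<phi>: "test_function \<Omega> \<phi>"
  obtain K where K: "compact K" "K \<subseteq> \<Omega>" "\<And>x. x \<notin> K \<Longrightarrow> \<phi> x = 0"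
    "\<And>x i. x \<notin> K \<Longrightarrow> partial_deriv i \<phi> x = 0"
    and \<phi>cont: "continuous_on UNIV \<phi>" "\<And>i. continuous_on UNIV (partial_deriv i \<phi>)"
    and \<phi>diff: "\<And>x. \<phi> differentiable (at x)"
    using test_functionE[OF \<phi>] by blast
  note glue = continuous_on_UNIV_if_compact_support[OF \<open>open \<Omega>\<close> K(1,2)]
  have cpart: "continuous_on \<Omega> (partial_deriv i \<phi>)" "continuous_on \<Omega> \<phi>"
    using \<phi>cont continuous_on_subset by blast+
  \<comment> \<open>\<open>T\<close> is \<open>Re\<close> or \<open>Im\<close>, and \<open>T (m x) * \<phi> x\<close> is the continuously differentiable test function\<close>
  have part: "(LINT x:\<Omega>|lebesgue. u x * of_real (T (m x) * partial_deriv i \<phi> x + T (G x $ i) * \<phi> x))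
      = - (LINT x:\<Omega>|lebesgue. g x $ i * of_real (T (m x) * \<phi> x))"
    if T: "bounded_linear T" for T :: "complex \<Rightarrow> real"
  proof (rule is_weak_gradient_test_C1[OF \<open>open \<Omega>\<close> g K(1,2)])
    have contT: "continuous_on \<Omega> (\<lambda>x. T (h x))" if "continuous_on \<Omega> h" for h
      using bounded_linear.continuous_on[OF T that] .
    show "continuous_on UNIV (\<lambda>x. T (m x) * \<phi> x)"
      by (rule glue) (auto intro!: continuous_intros contT contm cpart simp: K)
    show "continuous_on UNIV (\<lambda>x. T (m x) * partial_deriv i \<phi> x + T (G x $ i) * \<phi> x)"
      by (rule glue) (auto intro!: continuous_intros contT contm contG cpart simp: K)
    fix x t
    define y where "y = update_coord i t x"
    have "(\<lambda>x. T (m x) * \<phi> x) differentiable (at y) \<and>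
        partial_deriv i (\<lambda>x. T (m x) * \<phi> x) y = T (m y) * partial_deriv i \<phi> y + T (G y $ i) * \<phi> y"
    proof (cases "y \<in> \<Omega>")
      case True
      have dT: "((\<lambda>x. T (m x)) has_derivative (\<lambda>h. T (\<Sum>j\<in>UNIV. of_real (h $ j) * G y $ j))) (at y)"
        by (rule bounded_linear.has_derivative[OF T der[OF True]])
      then have dif: "(\<lambda>x. T (m x)) differentiable (at y)" by (auto simp: differentiable_def)
      have "partial_deriv i (\<lambda>x. T (m x)) y = T (G y $ i)"
        unfolding partial_deriv_eqI[OF dT] using exhaust_2[of i] by (auto simp: axis_def sum_2)
      with dif \<phi>diff show ?thesis by (simp add: partial_deriv_mult differentiable_mult)
    next
      case False
      then have y: "y \<notin> K" using K(2) by blast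
      have "((\<lambda>x. T (m x) * \<phi> x) has_derivative (\<lambda>h. 0)) (at y)"
        by (rule has_derivative_transform_within_open[OF has_derivative_const, of "- K" y 0])
           (use K(1,3) y in \<open>auto simp: compact_imp_closed open_Compl\<close>)
      with partial_deriv_eqI[OF this] y K(3,4) show ?thesis by (auto simp: differentiable_def)
    qed
    then show "((\<lambda>s. T (m (update_coord i s x)) * \<phi> (update_coord i s x)) has_real_derivative
        T (m (update_coord i t x)) * partial_deriv i \<phi> (update_coord i t x)
        + T (G (update_coord i t x) $ i) * \<phi> (update_coord i t x)) (at t)"
      using has_derivative_along_axis[of "\<lambda>x. T (m x) * \<phi> x" i t x] unfolding y_def by simp
  qed (simp add: K)
  have int: "set_integrable lebesgue \<Omega> (\<lambda>x. y x * f x)"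
    if "locally_integrable \<Omega> y" "continuous_on \<Omega> f" "\<And>x. x \<notin> K \<Longrightarrow> f x = 0"
    for y f :: "real^2 \<Rightarrow> complex"
    by (rule compact_support_integral(1)[OF that(1) K(1,2) glue[OF that(2,3)] that(3)])
  have split: "(LINT x:\<Omega>|lebesgue. y x * f x)
     = (LINT x:\<Omega>|lebesgue. y x * of_real (Re (f x))) + \<i> * (LINT x:\<Omega>|lebesgue. y x * of_real (Im (f x)))"
    if "locally_integrable \<Omega> y" "continuous_on \<Omega> f" "\<And>x. x \<notin> K \<Longrightarrow> f x = 0"
    for y f :: "real^2 \<Rightarrow> complex"
  proof -
    have *: "y x * f x = y x * of_real (Re (f x)) + \<i> * (y x * of_real (Im (f x)))" for x
      by (subst complex_eq[of "f x"]) (simp add: algebra_simps)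
    have "set_integrable lebesgue \<Omega> (\<lambda>x. y x * of_real (Re (f x)))"
      "set_integrable lebesgue \<Omega> (\<lambda>x. y x * of_real (Im (f x)))"
      by (intro int that continuous_intros; simp add: that)+
    then show ?thesis unfolding * by (simp add: set_integral_add)
  qed
  have "(LINT x:\<Omega>|lebesgue. u x * (m x * of_real (partial_deriv i \<phi> x) + G x $ i * of_real (\<phi> x)))
      = - (LINT x:\<Omega>|lebesgue. g x $ i * (m x * of_real (\<phi> x)))"
    using part[OF bounded_linear_Re] part[OF bounded_linear_Im]
    by (subst (1 2) split) (auto intro!: lu lg continuous_intros contm contG cpart simp: K)
  moreover have "(LINT x:\<Omega>|lebesgue. u x * (m x * of_real (partial_deriv i \<phi> x) + G x $ i * of_real (\<phi> x)))
      = (LINT x:\<Omega>|lebesgue. u x * (m x * of_real (partial_deriv i \<phi> x)))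
        + (LINT x:\<Omega>|lebesgue. u x * (G x $ i * of_real (\<phi> x)))"
    unfolding distrib_left
    by (intro set_integral_add int lu continuous_intros contm contG cpart; simp add: K)
  moreover have "(LINT x:\<Omega>|lebesgue. g x $ i * (m x * of_real (\<phi> x)) + u x * (G x $ i * of_real (\<phi> x)))
      = (LINT x:\<Omega>|lebesgue. g x $ i * (m x * of_real (\<phi> x)))
        + (LINT x:\<Omega>|lebesgue. u x * (G x $ i * of_real (\<phi> x)))"
    by (intro set_integral_add int lu lg continuous_intros contm contG cpart; simp add: K)
  ultimately show "(LINT x:\<Omega>|lebesgue. m x * u x * of_real (partial_deriv i \<phi> x))
     = - (LINT x:\<Omega>|lebesgue. (m x *s g x + u x *s G x) $ i * of_real (\<phi> x))"
    by (simp add: algebra_simps)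
qed

section \<open>Square integrability\<close>

text \<open>
An open set is a countable increasing union of compact sets.
\<close>

lemma set_borel_measurable_if_locally_integrable:
  assumes "open \<Omega>" "locally_integrable \<Omega> u"
  shows "set_borel_measurable lebesgue \<Omega> u"
proof -
  obtain C where C: "\<And>n::nat. compact (C n)" "\<And>n. C n \<subseteq> \<Omega>" "\<And>n. C n \<subseteq> interior (C (Suc n))" "\<Union>(range C) = \<Omega>"
    using open_Union_compact_subsets[OF \<open>open \<Omega>\<close>] by metis
  have "incseq C" using C(3) interior_subset by (intro incseq_SucI) blast
  show ?thesis unfolding set_borel_measurable_def
  proof (rule borel_measurable_LIMSEQ_metric)
    show "(\<lambda>x. indicator (C n) x *\<^sub>R u x) \<in> borel_measurable lebesgue" for n
      using locally_integrableD[OF assms(2) C(1,2)] by (auto simp: set_integrable_def)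
    fix x
    show "(\<lambda>n. indicator (C n) x *\<^sub>R u x) \<longlonglongrightarrow> indicator \<Omega> x *\<^sub>R u x"
      using LIMSEQ_indicator_incseq[OF \<open>incseq C\<close>, of x] C(4) by (intro tendsto_intros) simp
  qed
qed

lemma square_integrable_cong_AE:
  assumes "square_integrable \<Omega> u" "set_borel_measurable lebesgue \<Omega> v"
    and "AE x in lebesgue. x \<in> \<Omega> \<longrightarrow> v x = u x"
  shows "square_integrable \<Omega> v"
  unfolding square_integrable_def set_integrable_def
proof
  have meas: "(\<lambda>x. indicat_real \<Omega> x *\<^sub>R (cmod (w x))\<^sup>2) \<in> borel_measurable lebesgue"
    if "set_borel_measurable lebesgue \<Omega> w" for w
  proof -
    have "(\<lambda>x. (cmod (indicat_real \<Omega> x *\<^sub>R w x))\<^sup>2) \<in> borel_measurable lebesgue"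
      using that unfolding set_borel_measurable_def
      by (intro borel_measurable_power measurable_compose[OF _ borel_measurable_norm])
    then show ?thesis by (rule measurable_cong[THEN iffD1, rotated]) (auto simp: indicator_def)
  qed
  show "integrable lebesgue (\<lambda>x. indicat_real \<Omega> x *\<^sub>R (cmod (v x))\<^sup>2)"
  proof (rule integrable_cong_AE_imp)
    show "integrable lebesgue (\<lambda>x. indicat_real \<Omega> x *\<^sub>R (cmod (u x))\<^sup>2)"
      using assms(1) by (simp add: square_integrable_def set_integrable_def)
    show "AE x in lebesgue. indicat_real \<Omega> x *\<^sub>R (cmod (u x))\<^sup>2 = indicat_real \<Omega> x *\<^sub>R (cmod (v x))\<^sup>2"
      using assms(3) by eventually_elim (auto simp: indicator_def)
  qed (rule meas[OF assms(2)])
qed (rule assms(2))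

text \<open>
Square integrability passes from the weak gradient that witnesses membership in \<open>H1\<close> to the chosen representative,
because the two agree almost everywhere.
\<close>

lemma H1D:
  assumes "open \<Omega>" "u \<in> H1 \<Omega>"
  shows "square_integrable \<Omega> u" "is_weak_gradient \<Omega> u (weak_gradient \<Omega> u)"
    "\<And>i. square_integrable \<Omega> (\<lambda>x. weak_gradient \<Omega> u x $ i)"
proof -
  obtain g where g: "square_integrable \<Omega> u" "is_weak_gradient \<Omega> u g" "\<And>i. square_integrable \<Omega> (\<lambda>x. g x $ i)"
    using assms(2) unfolding H1_def by blast
  show "square_integrable \<Omega> u" by (rule g(1))
  show wg: "is_weak_gradient \<Omega> u (weak_gradient \<Omega> u)" by (rule weak_gradient_is[OF g(2)])
  show "square_integrable \<Omega> (\<lambda>x. weak_gradient \<Omega> u x $ i)" for i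
  proof (rule square_integrable_cong_AE[OF g(3)[of i]])
    show "set_borel_measurable lebesgue \<Omega> (\<lambda>x. weak_gradient \<Omega> u x $ i)"
      using wg unfolding is_weak_gradient_def
      by (intro set_borel_measurable_if_locally_integrable[OF \<open>open \<Omega>\<close>]) blast
    show "AE x in lebesgue. x \<in> \<Omega> \<longrightarrow> weak_gradient \<Omega> u x $ i = g x $ i"
      using weak_gradient_AE_eq[OF \<open>open \<Omega>\<close> g(2)] by eventually_elim simp
  qed
qed

lemma square_integrable_product:
  assumes "open \<Omega>" "square_integrable \<Omega> u" "square_integrable \<Omega> v"
    and "continuous_on \<Omega> c" "bounded (c ` \<Omega>)"
  shows "set_integrable lebesgue \<Omega> (\<lambda>x. c x * (u x * cnj (v x)))"
proof -
  obtain C where C: "\<And>x. x \<in> \<Omega> \<Longrightarrow> cmod (c x) \<le> C" using assms(5) by (auto simp: bounded_iff)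
  have int: "set_integrable lebesgue \<Omega> (\<lambda>x. u x * cnj (v x))"
  proof (rule set_integrable_bound)
    show "set_integrable lebesgue \<Omega> (\<lambda>x. (cmod (u x))\<^sup>2 + (cmod (v x))\<^sup>2)"
      using assms by (intro set_integral_add) (auto simp: square_integrable_def)
    have "(\<lambda>x. indicat_real \<Omega> x *\<^sub>R u x * cnj (indicat_real \<Omega> x *\<^sub>R v x)) \<in> borel_measurable lebesgue"
      using assms(2,3) unfolding square_integrable_def set_borel_measurable_def
      by (intro borel_measurable_times
            measurable_compose[OF _ borel_measurable_continuous_onI[of cnj]] continuous_intros) auto
    then show "set_borel_measurable lebesgue \<Omega> (\<lambda>x. u x * cnj (v x))"
      unfolding set_borel_measurable_def
      by (rule measurable_cong[THEN iffD1, rotated]) (auto simp: indicator_def)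
    have "cmod (u x * cnj (v x)) \<le> norm ((cmod (u x))\<^sup>2 + (cmod (v x))\<^sup>2)" for x
    proof -
      have "2 * (cmod (u x) * cmod (v x)) \<le> (cmod (u x))\<^sup>2 + (cmod (v x))\<^sup>2"
        using sum_squares_bound[of "cmod (u x)" "cmod (v x)"] by (simp add: mult.assoc)
      moreover have "0 \<le> cmod (u x) * cmod (v x)" by simp
      ultimately have "cmod (u x) * cmod (v x) \<le> (cmod (u x))\<^sup>2 + (cmod (v x))\<^sup>2" by linarith
      then show ?thesis by (simp add: norm_mult)
    qed
    then show "AE x in lebesgue. x \<in> \<Omega> \<longrightarrow> cmod (u x * cnj (v x)) \<le> norm ((cmod (u x))\<^sup>2 + (cmod (v x))\<^sup>2)"
      by (intro AE_I2 impI)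
  qed
  have meas: "set_borel_measurable lebesgue \<Omega> c"
    using assms(1,4) by (intro set_borel_measurable_continuous_lebesgue borel_open)
  show ?thesis
    by (rule set_integrable_lebesgue_mult_bounded[OF int meas _ C]) (use assms(1) in simp_all)
qed

section \<open>Calculus in polar coordinates\<close>

definition polar_point :: "real \<Rightarrow> real \<Rightarrow> real^2" where
  "polar_point r \<theta> = vector [r * cos \<theta>, r * sin \<theta>]"

abbreviation angle :: "real^2 \<Rightarrow> real" where
  "angle x \<equiv> Arg (Complex (x $ 1) (x $ 2))"

lemma norm_real2: "norm (x :: real^2) = sqrt ((x $ 1)\<^sup>2 + (x $ 2)\<^sup>2)"
  by (simp add: norm_vec_def L2_set_def sum_2)

lemma polar_point_norm_angle: "x = polar_point (norm x) (angle x)"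
proof -
  have "norm x = cmod (Complex (x $ 1) (x $ 2))" by (simp add: norm_real2 cmod_def)
  moreover have "Complex (x $ 1) (x $ 2) = rcis (cmod (Complex (x $ 1) (x $ 2))) (angle x)"
    by (simp add: rcis_cmod_Arg)
  ultimately have "x $ 1 = norm x * cos (angle x)" "x $ 2 = norm x * sin (angle x)"
    by (metis Re_rcis complex.sel(1), metis Im_rcis complex.sel(2))
  then show ?thesis by (simp add: polar_point_def vec_eq_iff forall_2)
qed

lemma norm_polar_point: "norm (polar_point r \<theta>) = \<bar>r\<bar>"
proof -
  have "(r * cos \<theta>)\<^sup>2 + (r * sin \<theta>)\<^sup>2 = r\<^sup>2"
    by (simp add: power_mult_distrib flip: distrib_left)
  then show ?thesis by (simp add: norm_real2 polar_point_def)
qed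

definition periodic_in_angle :: "(real \<Rightarrow> real \<Rightarrow> 'c) \<Rightarrow> bool" where
  "periodic_in_angle f \<longleftrightarrow> (\<forall>r>0. \<forall>\<theta>. f r (\<theta> + 2 * pi) = f r \<theta>)"

lemma periodic_in_angle_int:
  assumes "periodic_in_angle f" "0 < r"
  shows "f r (\<theta> + 2 * pi * of_int n) = f r \<theta>"
proof -
  have nat: "f r (\<theta> + 2 * pi * real k) = f r \<theta>" for k \<theta>
  proof (induction k)
    case (Suc k)
    have "\<theta> + 2 * pi * real (Suc k) = (\<theta> + 2 * pi * real k) + 2 * pi" by (simp add: algebra_simps)
    then show ?case using Suc assms unfolding periodic_in_angle_def by metis
  qed simp
  show ?thesis
  proof (cases n)
    case (nonneg k)
    then show ?thesis using nat by simp
  next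
    case (neg k)
    then have k: "real (Suc k) = - real_of_int n" by simp
    show ?thesis using nat[of "\<theta> + 2 * pi * of_int n" "Suc k"] unfolding k by simp
  qed
qed

lemma on_plane_polar_point:
  assumes "periodic_in_angle f" "0 < r"
  shows "on_plane f (polar_point r \<theta>) = f r \<theta>"
proof -
  define x where "x = polar_point r \<theta>"
  have n: "norm x = r" using assms(2) by (simp add: x_def norm_polar_point)
  have "polar_point r (angle x) = polar_point r \<theta>"
    using polar_point_norm_angle[of x] n by (simp add: x_def)
  then have "cos (angle x) = cos \<theta>" "sin (angle x) = sin \<theta>"
    using assms(2) by (simp_all add: polar_point_def vec_eq_iff forall_2)
  then obtain k :: int where k: "angle x = \<theta> + 2 * pi * k"
    using sin_cos_eq_iff by metis
  have "on_plane f x = f r (angle x)" by (simp add: on_plane_def n)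
  also have "\<dots> = f r \<theta>" unfolding k by (rule periodic_in_angle_int[OF assms])
  finally show ?thesis unfolding x_def .
qed

text \<open>
The principal argument jumps along the negative real axis. In coordinates rotated by the angle \<open>\<theta>\<close> of \<open>x\<close>
itself, \<open>\<theta> + arctan (q / p)\<close> is a smooth branch on the half plane \<open>p > 0\<close>, which contains \<open>x\<close>.
\<close>

lemma local_angle:
  assumes "x \<noteq> 0"
  obtains \<Theta> U where "open U" "x \<in> U" "\<And>y. y \<in> U \<Longrightarrow> y \<noteq> 0 \<and> y = polar_point (norm y) (\<Theta> y)"
    "\<Theta> x = angle x"
    "(\<Theta> has_derivative (\<lambda>h. (cos (angle x) * h $ 2 - sin (angle x) * h $ 1) / norm x)) (at x)"
proof -
  define \<theta> where "\<theta> = angle x"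
  define p where "p y = cos \<theta> * y $ 1 + sin \<theta> * y $ 2" for y :: "real^2"
  define q where "q y = cos \<theta> * y $ 2 - sin \<theta> * y $ 1" for y :: "real^2"
  define \<Theta> where "\<Theta> y = \<theta> + arctan (q y / p y)" for y
  define U where "U = {y. 0 < p y}"
  have x: "x $ 1 = norm x * cos \<theta>" "x $ 2 = norm x * sin \<theta>"
    using polar_point_norm_angle[of x] unfolding \<theta>_def[symmetric] polar_point_def
    by (metis vector_2)+
  have px: "p x = norm x"
  proof -
    have "p x = norm x * ((cos \<theta>)\<^sup>2 + (sin \<theta>)\<^sup>2)"
      unfolding p_def x by (simp only: power2_eq_square algebra_simps)
    then show ?thesis by simp
  qed
  have qx: "q x = 0" unfolding q_def x by simp
  have nx: "0 < norm x" using assms by simp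
  show ?thesis
  proof
    show "open U" unfolding U_def p_def by (intro open_Collect_less continuous_intros)
    show "x \<in> U" using px nx by (simp add: U_def)
    show "\<Theta> x = angle x" by (simp add: \<Theta>_def qx \<theta>_def)
    show "y \<noteq> 0 \<and> y = polar_point (norm y) (\<Theta> y)" if "y \<in> U" for y
    proof
      have p: "0 < p y" using that by (simp add: U_def)
      then show "y \<noteq> 0" by (auto simp: p_def)
      have cs: "(cos \<theta>)\<^sup>2 + (sin \<theta>)\<^sup>2 = 1" by simp
      have pq: "(p y)\<^sup>2 + (q y)\<^sup>2 = (norm y)\<^sup>2"
      proof -
        have "(p y)\<^sup>2 + (q y)\<^sup>2 = ((cos \<theta>)\<^sup>2 + (sin \<theta>)\<^sup>2) * ((y $ 1)\<^sup>2 + (y $ 2)\<^sup>2)"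
          unfolding p_def q_def by algebra
        then show ?thesis unfolding cs by (simp add: norm_real2)
      qed
      have "sqrt (1 + (q y / p y)\<^sup>2) = norm y / p y"
      proof -
        have "1 + (q y / p y)\<^sup>2 = (norm y / p y)\<^sup>2"
          using p pq by (simp add: power_divide field_simps)
        then show ?thesis using p by simp
      qed
      then have ca: "norm y * cos (arctan (q y / p y)) = p y" "norm y * sin (arctan (q y / p y)) = q y"
        using p \<open>y \<noteq> 0\<close> by (simp_all add: cos_arctan sin_arctan)
      define \<phi> where "\<phi> = arctan (q y / p y)"
      have "norm y * cos (\<theta> + \<phi>) = cos \<theta> * (norm y * cos \<phi>) - sin \<theta> * (norm y * sin \<phi>)"
        "norm y * sin (\<theta> + \<phi>) = sin \<theta> * (norm y * cos \<phi>) + cos \<theta> * (norm y * sin \<phi>)"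
        unfolding cos_add sin_add by (simp_all only: algebra_simps)
      then have "norm y * cos (\<Theta> y) = cos \<theta> * p y - sin \<theta> * q y"
        "norm y * sin (\<Theta> y) = sin \<theta> * p y + cos \<theta> * q y"
        unfolding ca[folded \<phi>_def] by (simp_all only: \<Theta>_def \<phi>_def)
      moreover have "cos \<theta> * p y - sin \<theta> * q y = ((cos \<theta>)\<^sup>2 + (sin \<theta>)\<^sup>2) * y $ 1"
        "sin \<theta> * p y + cos \<theta> * q y = ((cos \<theta>)\<^sup>2 + (sin \<theta>)\<^sup>2) * y $ 2"
        unfolding p_def q_def by - algebra+
      ultimately show "y = polar_point (norm y) (\<Theta> y)"
        unfolding cs by (simp add: polar_point_def vec_eq_iff forall_2)
    qed
    have dc: "((\<lambda>y::real^2. y $ j) has_derivative (\<lambda>h. h $ j)) (at x)" for j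
      by (rule bounded_linear.has_derivative[OF bounded_linear_vec_nth has_derivative_ident])
    have dp: "(p has_derivative p) (at x)" and dq: "(q has_derivative q) (at x)"
      unfolding p_def q_def by (auto intro!: derivative_eq_intros dc)
    have "((\<lambda>y. q y / p y) has_derivative (\<lambda>h. q h / norm x)) (at x)"
      using has_derivative_divide[OF dq dp] px qx nx by (simp add: field_simps)
    moreover have "(arctan has_derivative (\<lambda>h. h)) (at (q x / p x))"
      using DERIV_arctan[of "q x / p x"] unfolding has_field_derivative_def
      by (rule has_derivative_eq_rhs) (auto simp: qx)
    ultimately have "((\<lambda>y. arctan (q y / p y)) has_derivative (\<lambda>h. q h / norm x)) (at x)"
      by (rule has_derivative_compose)
    then have "(\<Theta> has_derivative (\<lambda>h. q h / norm x)) (at x)"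
      unfolding \<Theta>_def by (auto dest: has_derivative_add[OF has_derivative_const])
    then show "(\<Theta> has_derivative (\<lambda>h. (cos (angle x) * h $ 2 - sin (angle x) * h $ 1) / norm x)) (at x)"
      by (simp add: q_def \<theta>_def)
  qed
qed

lemma isCont_on_plane:
  fixes f :: "real \<Rightarrow> real \<Rightarrow> 'b::real_normed_vector"
  assumes "periodic_in_angle f" "x \<noteq> 0" "isCont (\<lambda>z. f (fst z) (snd z)) (norm x, angle x)"
  shows "isCont (on_plane f) x"
proof -
  obtain \<Theta> U where U: "open U" "x \<in> U" "\<And>y. y \<in> U \<Longrightarrow> y \<noteq> 0 \<and> y = polar_point (norm y) (\<Theta> y)"
    "\<Theta> x = angle x"
    "(\<Theta> has_derivative (\<lambda>h. (cos (angle x) * h $ 2 - sin (angle x) * h $ 1) / norm x)) (at x)"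
    by (rule local_angle[OF assms(2)]) (rule that)
  have "isCont \<Theta> x" using U(5) by (rule has_derivative_continuous)
  then have "isCont (\<lambda>y. (norm y, \<Theta> y)) x" by (intro continuous_intros)
  from isCont_o2[OF this, of "\<lambda>z. f (fst z) (snd z)"]
  have "isCont (\<lambda>y. f (norm y) (\<Theta> y)) x" using assms(3) U(4) by simp
  moreover have "\<forall>\<^sub>F y in nhds x. on_plane f y = f (norm y) (\<Theta> y)"
    unfolding eventually_nhds
  proof (intro exI[of _ U] conjI ballI U(1,2))
    show "on_plane f y = f (norm y) (\<Theta> y)" if "y \<in> U" for y
    proof -
      have "on_plane f (polar_point (norm y) (\<Theta> y)) = f (norm y) (\<Theta> y)"
        by (rule on_plane_polar_point[OF assms(1)]) (simp add: conjunct1[OF U(3)[OF that]])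
      then show ?thesis by (simp only: conjunct2[OF U(3)[OF that], symmetric])
    qed
  qed
  ultimately show ?thesis by (simp only: isCont_cong)
qed

lemma partials_of_total_derivative:
  assumes D: "((\<lambda>z. f (fst z) (snd z)) has_derivative D) (at (r, \<theta>))"
  shows "d_r f r \<theta> = D (1, 0)" "d_th f r \<theta> = D (0, 1)"
proof -
  interpret D: bounded_linear D using D by (rule has_derivative_bounded_linear)
  have "((\<lambda>s. (s, \<theta>)) has_derivative (\<lambda>h. (h, 0))) (at r)" by (auto intro!: derivative_eq_intros)
  from has_derivative_compose[OF this, of "\<lambda>z. f (fst z) (snd z)" D] D
  have "((\<lambda>s. f s \<theta>) has_derivative (\<lambda>h. D (h, 0))) (at r)" by simp
  moreover have "(\<lambda>h. D (h, 0)) = (\<lambda>h. h *\<^sub>R D (1, 0))" by (rule ext) (simp flip: D.scaleR)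
  ultimately show "d_r f r \<theta> = D (1, 0)" unfolding d_r_def
    by (intro vector_derivative_at) (simp only: has_vector_derivative_def)
  have "((\<lambda>s. (r, s)) has_derivative (\<lambda>h. (0, h))) (at \<theta>)" by (auto intro!: derivative_eq_intros)
  from has_derivative_compose[OF this, of "\<lambda>z. f (fst z) (snd z)" D] D
  have "((\<lambda>s. f r s) has_derivative (\<lambda>h. D (0, h))) (at \<theta>)" by simp
  moreover have "(\<lambda>h. D (0, h)) = (\<lambda>h. h *\<^sub>R D (0, 1))" by (rule ext) (simp flip: D.scaleR)
  ultimately show "d_th f r \<theta> = D (0, 1)" unfolding d_th_def
    by (intro vector_derivative_at) (simp only: has_vector_derivative_def)
qed

text \<open>
The relation \<open>\<nabla> = R\<^sub>\<theta> (\<partial>\<^sub>r, \<partial>\<^sub>\<theta> / r)\<close>, as a statement about the total derivative. It also holds across the cut of the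
principal argument, since by periodicity \<open>f\<close> may be evaluated at the smooth local branch of the angle.
\<close>

lemma has_derivative_on_plane:
  fixes f :: "real \<Rightarrow> real \<Rightarrow> complex"
  assumes "periodic_in_angle f" "x \<noteq> 0"
    and D: "((\<lambda>z. f (fst z) (snd z)) has_derivative D) (at (norm x, angle x))"
  shows "(on_plane f has_derivative
      (\<lambda>h. \<Sum>j\<in>UNIV. of_real (h $ j) * on_plane (\<lambda>r \<theta>. cmat (rot \<theta>) *v hat_grad f r \<theta>) x $ j)) (at x)"
proof -
  obtain \<Theta> U where U: "open U" "x \<in> U" "\<And>y. y \<in> U \<Longrightarrow> y \<noteq> 0 \<and> y = polar_point (norm y) (\<Theta> y)"
    "\<Theta> x = angle x"
    "(\<Theta> has_derivative (\<lambda>h. (cos (angle x) * h $ 2 - sin (angle x) * h $ 1) / norm x)) (at x)"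
    by (rule local_angle[OF assms(2)]) (rule that)
  define \<theta> where "\<theta> = angle x"
  define r where "r = norm x"
  interpret D: bounded_linear D using D by (rule has_derivative_bounded_linear)
  have x: "x $ 1 = r * cos \<theta>" "x $ 2 = r * sin \<theta>"
    using polar_point_norm_angle[of x] unfolding \<theta>_def[symmetric] r_def[symmetric] polar_point_def
    by (metis vector_2)+
  have r: "0 < r" using assms(2) by (simp add: r_def)
  have dn: "(norm has_derivative (\<lambda>h. cos \<theta> * h $ 1 + sin \<theta> * h $ 2)) (at x)"
  proof -
    have "(\<lambda>h::real^2. h \<bullet> sgn x) = (\<lambda>h. cos \<theta> * h $ 1 + sin \<theta> * h $ 2)"
      using r by (auto simp: inner_vec_def sum_2 sgn_div_norm x r_def[symmetric] field_simps)
    then show ?thesis using has_derivative_norm[OF assms(2)] by simp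
  qed
  have comp: "((\<lambda>y. f (norm y) (\<Theta> y)) has_derivative
      (\<lambda>h. D (cos \<theta> * h $ 1 + sin \<theta> * h $ 2, (cos \<theta> * h $ 2 - sin \<theta> * h $ 1) / r))) (at x)"
    using has_derivative_compose[OF has_derivative_Pair[OF dn U(5)], of "\<lambda>z. f (fst z) (snd z)" D] D U(4)
    by (simp add: \<theta>_def r_def)
  have part: "d_r f r \<theta> = D (1, 0)" "d_th f r \<theta> = D (0, 1)"
    using partials_of_total_derivative[OF D] by (simp_all add: r_def \<theta>_def)
  have lin: "D (s, t) = s *\<^sub>R d_r f r \<theta> + t *\<^sub>R d_th f r \<theta>" for s t
    unfolding part using D.add[of "(s, 0)" "(0, t)"] D.scaleR[of s "(1, 0)"] D.scaleR[of t "(0, 1)"] by simp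
  have eq: "D (cos \<theta> * h $ 1 + sin \<theta> * h $ 2, (cos \<theta> * h $ 2 - sin \<theta> * h $ 1) / r)
      = (\<Sum>j\<in>UNIV. of_real (h $ j) * on_plane (\<lambda>r \<theta>. cmat (rot \<theta>) *v hat_grad f r \<theta>) x $ j)" for h
    unfolding lin on_plane_def r_def[symmetric] \<theta>_def[symmetric] using r
    by (simp add: sum_2 matrix_vector_mult_def cmat_def rot_def hat_grad_def scaleR_conv_of_real field_simps)
  show ?thesis
  proof (rule has_derivative_transform_within_open[OF comp[unfolded eq] U(1,2)])
    show "f (norm y) (\<Theta> y) = on_plane f y" if "y \<in> U" for y
    proof -
      have "on_plane f (polar_point (norm y) (\<Theta> y)) = f (norm y) (\<Theta> y)"
        by (rule on_plane_polar_point[OF assms(1)]) (simp add: conjunct1[OF U(3)[OF that]])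
      then show ?thesis by (simp only: conjunct2[OF U(3)[OF that], symmetric])
    qed
  qed
qed

section \<open>The star-shaped layer\<close>

text \<open>
The class of admissible coefficients: it is closed under the arithmetic from which all coefficients are built, and its
members become continuous on the punctured plane and bounded on the layer.
\<close>

definition polar_coeff :: "(real \<Rightarrow> real \<Rightarrow> 'b::real_normed_vector) \<Rightarrow> bool" where
  "polar_coeff f \<longleftrightarrow> periodic_in_angle f \<and> continuous_on ({0<..} \<times> UNIV) (\<lambda>z. f (fst z) (snd z))"

lemma isCont_on_plane_polar_coeff:
  assumes "polar_coeff f" "x \<noteq> 0"
  shows "isCont (on_plane f) x"
proof (rule isCont_on_plane)
  have "open ({0::real<..} \<times> (UNIV :: real set))" by (intro open_Times) auto
  then show "isCont (\<lambda>z. f (fst z) (snd z)) (norm x, angle x)"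
    using assms by (auto simp: polar_coeff_def continuous_on_eq_continuous_at)
qed (use assms in \<open>auto simp: polar_coeff_def\<close>)

locale star_shaped_layer =
  fixes a b :: "real \<Rightarrow> real"
  assumes a_cont: "continuous_on UNIV a" and a_periodic: "\<And>\<theta>. a (\<theta> + 2 * pi) = a \<theta>"
    and b_cont: "continuous_on UNIV b" and b_periodic: "\<And>\<theta>. b (\<theta> + 2 * pi) = b \<theta>"
    and a_pos: "\<And>\<theta>. 0 < a \<theta>"
begin

lemma Omega2_iff: "x \<in> Omega2 a b \<longleftrightarrow> a (angle x) < norm x \<and> norm x < b (angle x)"
proof
  assume "x \<in> Omega2 a b"
  then obtain r \<theta> where x: "x = polar_point r \<theta>" "a \<theta> < r" "r < b \<theta>"
    by (auto simp: Omega2_def polar_point_def)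
  have r: "0 < r" using x(2) a_pos[of \<theta>] by linarith
  have "periodic_in_angle (\<lambda>r. a)" "periodic_in_angle (\<lambda>r. b)"
    using a_periodic b_periodic by (auto simp: periodic_in_angle_def)
  from this[THEN on_plane_polar_point, OF r, of \<theta>] have "a (angle x) = a \<theta>" "b (angle x) = b \<theta>"
    by (simp_all add: on_plane_def x(1))
  then show "a (angle x) < norm x \<and> norm x < b (angle x)" using x r by (simp add: norm_polar_point)
next
  assume "a (angle x) < norm x \<and> norm x < b (angle x)"
  then show "x \<in> Omega2 a b"
    using polar_point_norm_angle[of x] unfolding Omega2_def polar_point_def by blast
qed

lemma Omega2_nonzero: "x \<in> Omega2 a b \<Longrightarrow> x \<noteq> 0"
  using a_pos[of "angle x"] by (auto simp: Omega2_iff)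

lemma polar_coeff_radial: "continuous_on UNIV g \<Longrightarrow> (\<And>\<theta>. g (\<theta> + 2 * pi) = g \<theta>) \<Longrightarrow> polar_coeff (\<lambda>r. g)"
  unfolding polar_coeff_def periodic_in_angle_def
  by (simp add: continuous_on_compose2[of UNIV g _ snd] continuous_on_snd continuous_on_id)

lemma continuous_on_plane: "polar_coeff f \<Longrightarrow> continuous_on (Omega2 a b) (on_plane f)"
  using isCont_on_plane_polar_coeff Omega2_nonzero by (blast intro: continuous_at_imp_continuous_on)

lemma open_Omega2: "open (Omega2 a b)"
proof -
  have "continuous_on (- {0}) (on_plane (\<lambda>r. g))"
    if "continuous_on UNIV g" "\<And>\<theta>. g (\<theta> + 2 * pi) = g \<theta>" for g :: "real \<Rightarrow> real"
    using isCont_on_plane_polar_coeff[OF polar_coeff_radial[OF that]]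
    by (blast intro: continuous_at_imp_continuous_on)
  then have c: "continuous_on (- {0}) (\<lambda>x. a (angle x))" "continuous_on (- {0}) (\<lambda>x. b (angle x))"
    using a_cont a_periodic b_cont b_periodic by (auto simp: on_plane_def[abs_def])
  have "open (- {0} \<inter> (\<lambda>x. norm x - a (angle x)) -` {0<..})"
       "open (- {0} \<inter> (\<lambda>x. b (angle x) - norm x) -` {0<..})"
    by (intro continuous_open_preimage continuous_intros c; simp)+
  then have "open ((- {0} \<inter> (\<lambda>x. norm x - a (angle x)) -` {0<..})
      \<inter> (- {0} \<inter> (\<lambda>x. b (angle x) - norm x) -` {0<..}))" by (rule open_Int)
  moreover have "Omega2 a b = (- {0} \<inter> (\<lambda>x. norm x - a (angle x)) -` {0<..})
      \<inter> (- {0} \<inter> (\<lambda>x. b (angle x) - norm x) -` {0<..})"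
  proof (intro set_eqI)
    show "x \<in> Omega2 a b \<longleftrightarrow> x \<in> (- {0} \<inter> (\<lambda>x. norm x - a (angle x)) -` {0<..})
      \<inter> (- {0} \<inter> (\<lambda>x. b (angle x) - norm x) -` {0<..})" for x
      using Omega2_nonzero[of x] unfolding Omega2_iff by (cases "x = 0") auto
  qed
  ultimately show ?thesis by simp
qed

text \<open>
In polar coordinates the layer lies in a compact rectangle that stays away from \<open>r = 0\<close>, because the positive
function \<open>a\<close> attains its minimum over a period.
\<close>

lemma bounded_on_plane:
  assumes "polar_coeff f"
  shows "bounded (on_plane f ` Omega2 a b)"
proof -
  define I where "I = {- pi..pi}"
  have "compact I" "I \<noteq> {}" by (auto simp: I_def)
  obtain \<theta>1 where \<theta>1: "\<And>\<theta>. \<theta> \<in> I \<Longrightarrow> a \<theta>1 \<le> a \<theta>"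
    using continuous_attains_inf[OF \<open>compact I\<close> \<open>I \<noteq> {}\<close> continuous_on_subset[OF a_cont]] by blast
  obtain \<theta>2 where \<theta>2: "\<And>\<theta>. \<theta> \<in> I \<Longrightarrow> b \<theta> \<le> b \<theta>2"
    using continuous_attains_sup[OF \<open>compact I\<close> \<open>I \<noteq> {}\<close> continuous_on_subset[OF b_cont]] by blast
  define C where "C = {a \<theta>1..b \<theta>2} \<times> I"
  have "compact C" unfolding C_def using \<open>compact I\<close> by (intro compact_Times) auto
  moreover have "continuous_on C (\<lambda>z. f (fst z) (snd z))"
    using assms a_pos[of \<theta>1] unfolding polar_coeff_def C_def by (auto elim: continuous_on_subset)
  ultimately have "bounded ((\<lambda>z. f (fst z) (snd z)) ` C)"
    by (intro compact_imp_bounded compact_continuous_image)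
  moreover have "on_plane f ` Omega2 a b \<subseteq> (\<lambda>z. f (fst z) (snd z)) ` C"
  proof
    fix y assume "y \<in> on_plane f ` Omega2 a b"
    then obtain x where x: "x \<in> Omega2 a b" "y = on_plane f x" by blast
    have "angle x \<in> I" using mpi_less_Arg Arg_le_pi by (auto simp: I_def less_imp_le)
    then have "(norm x, angle x) \<in> C"
      using x(1) \<theta>1[of "angle x"] \<theta>2[of "angle x"] by (auto simp: C_def Omega2_iff)
    then show "y \<in> (\<lambda>z. f (fst z) (snd z)) ` C"
      unfolding x(2) on_plane_def by force
  qed
  ultimately show ?thesis by (rule bounded_subset)
qed

end

section \<open>Coefficients in polar coordinates\<close>

lemma polar_coeff_cong:
  assumes "\<And>r \<theta>. 0 < r \<Longrightarrow> f r \<theta> = g r \<theta>" "polar_coeff g"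
  shows "polar_coeff f"
  using assms unfolding polar_coeff_def periodic_in_angle_def
  by (auto elim!: continuous_on_eq)

lemma polar_coeff_const: "polar_coeff (\<lambda>r \<theta>. c)"
  and polar_coeff_radius: "polar_coeff (\<lambda>r \<theta>. r)"
  unfolding polar_coeff_def periodic_in_angle_def by (auto intro: continuous_intros)

lemma polar_coeff_of_real:
  "polar_coeff f \<Longrightarrow> polar_coeff (\<lambda>r \<theta>. of_real (f r \<theta>) :: complex)"
  unfolding polar_coeff_def periodic_in_angle_def by (auto intro: continuous_intros)

lemma polar_coeff_add: "polar_coeff f \<Longrightarrow> polar_coeff g \<Longrightarrow> polar_coeff (\<lambda>r \<theta>. f r \<theta> + g r \<theta>)"
  and polar_coeff_diff: "polar_coeff f \<Longrightarrow> polar_coeff g \<Longrightarrow> polar_coeff (\<lambda>r \<theta>. f r \<theta> - g r \<theta>)"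
  and polar_coeff_minus: "polar_coeff f \<Longrightarrow> polar_coeff (\<lambda>r \<theta>. - f r \<theta>)"
  unfolding polar_coeff_def periodic_in_angle_def by (auto intro: continuous_intros)

lemma polar_coeff_mult:
  fixes f g :: "real \<Rightarrow> real \<Rightarrow> 'b::real_normed_algebra"
  shows "polar_coeff f \<Longrightarrow> polar_coeff g \<Longrightarrow> polar_coeff (\<lambda>r \<theta>. f r \<theta> * g r \<theta>)"
  unfolding polar_coeff_def periodic_in_angle_def by (auto intro: continuous_intros)

lemma polar_coeff_power:
  fixes f :: "real \<Rightarrow> real \<Rightarrow> 'b::real_normed_div_algebra"
  shows "polar_coeff f \<Longrightarrow> polar_coeff (\<lambda>r \<theta>. f r \<theta> ^ n)"
  unfolding polar_coeff_def periodic_in_angle_def by (auto intro: continuous_intros)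

lemma polar_coeff_divide:
  fixes f g :: "real \<Rightarrow> real \<Rightarrow> 'b::real_normed_field"
  assumes "polar_coeff f" "polar_coeff g" "\<And>r \<theta>. 0 < r \<Longrightarrow> g r \<theta> \<noteq> 0"
  shows "polar_coeff (\<lambda>r \<theta>. f r \<theta> / g r \<theta>)"
  using assms unfolding polar_coeff_def periodic_in_angle_def by (auto intro!: continuous_on_divide)

lemma polar_coeff_exp:
  fixes f :: "real \<Rightarrow> real \<Rightarrow> 'b::{real_normed_field,banach}"
  shows "polar_coeff f \<Longrightarrow> polar_coeff (\<lambda>r \<theta>. exp (f r \<theta>))"
  unfolding polar_coeff_def periodic_in_angle_def by (auto intro: continuous_intros)

lemma polar_coeff_cos: "polar_coeff (\<lambda>r. cos)" and polar_coeff_sin: "polar_coeff (\<lambda>r. sin)"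
  unfolding polar_coeff_def periodic_in_angle_def
  by (auto intro!: continuous_on_cos continuous_on_sin continuous_on_snd continuous_on_id)

lemmas polar_coeff_intros = polar_coeff_const polar_coeff_radius polar_coeff_of_real polar_coeff_add
  polar_coeff_diff polar_coeff_minus polar_coeff_mult polar_coeff_power polar_coeff_divide
  polar_coeff_exp polar_coeff_cos polar_coeff_sin

locale layer_transform = star_shaped_layer a b for a b +
  fixes \<tau>0 :: real
  assumes a_C1: "a C1_differentiable_on UNIV" and \<tau>0_pos: "0 < \<tau>0"
begin

abbreviation \<tau> :: "real \<Rightarrow> real \<Rightarrow> real" where "\<tau> \<equiv> tau a \<tau>0"
abbreviation a' :: "real \<Rightarrow> real" where "a' \<equiv> deriv a"

text \<open>
The closed form of the angular derivative of \<open>\<tau>\<close>, from which continuity and periodicity can be read off.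
\<close>

definition \<tau>\<theta> :: "real \<Rightarrow> real \<Rightarrow> real" where
  "\<tau>\<theta> r \<theta> = a' \<theta> * (1 - \<tau>0 * a \<theta>) * exp (\<tau>0 * (r - a \<theta>))"

lemma a_deriv: "(a has_real_derivative a' \<theta>) (at \<theta>)"
  using a_C1 unfolding C1_differentiable_on_def
  by (metis DERIV_imp_deriv UNIV_I has_real_derivative_iff_has_vector_derivative)

lemma a'_cont: "continuous_on UNIV a'"
proof -
  obtain D where D: "\<And>x. (a has_vector_derivative D x) (at x)" "continuous_on UNIV D"
    using a_C1 unfolding C1_differentiable_on_def by auto
  have "D x = a' x" for x
    using D(1)[of x] a_deriv[of x] vector_derivative_at
    unfolding has_real_derivative_iff_has_vector_derivative by metis
  then have "D = a'" by (rule ext)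
  with D(2) show ?thesis by simp
qed

lemma a'_periodic: "a' (\<theta> + 2 * pi) = a' \<theta>"
proof -
  have "((\<lambda>x. a (x + 2 * pi)) has_real_derivative a' (\<theta> + 2 * pi)) (at \<theta>)"
    using a_deriv[of "\<theta> + 2 * pi"] by (simp add: DERIV_shift)
  then show ?thesis using a_deriv[of \<theta>] DERIV_unique by (simp add: a_periodic)
qed

lemma \<tau>_pos: "0 < \<tau> r \<theta>"
  by (simp add: tau_def a_pos)

lemma \<tau>_total_derivative:
  "((\<lambda>z. \<tau> (fst z) (snd z)) has_derivative
     (\<lambda>h. \<tau>0 * \<tau> r \<theta> * fst h + \<tau>\<theta> r \<theta> * snd h)) (at (r, \<theta>))"
proof -
  have da: "((\<lambda>z. a (snd z)) has_derivative (\<lambda>h. a' \<theta> * snd h)) (at (r, \<theta>))"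
    by (rule has_derivative_compose[of snd snd _ _ a])
       (auto intro!: derivative_eq_intros simp: a_deriv[unfolded has_field_derivative_def])
  show ?thesis unfolding tau_def \<tau>\<theta>_def
    by (auto intro!: derivative_eq_intros da simp: algebra_simps)
qed

lemma d_r_\<tau>: "d_r \<tau> r \<theta> = \<tau>0 * \<tau> r \<theta>" and d_th_\<tau>: "d_th \<tau> r \<theta> = \<tau>\<theta> r \<theta>"
  using partials_of_total_derivative[OF \<tau>_total_derivative] by simp_all

lemma w_total_derivative:
  "((\<lambda>z. w_fun a \<tau>0 k (fst z) (snd z)) has_derivative
     (\<lambda>h. \<i> * of_real (k * (\<tau>0 * \<tau> r \<theta> * fst h + (\<tau>\<theta> r \<theta> - a' \<theta>) * snd h)) * w_fun a \<tau>0 k r \<theta>)) (at (r, \<theta>))"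
proof -
  have da: "((\<lambda>z. a (snd z)) has_derivative (\<lambda>h. a' \<theta> * snd h)) (at (r, \<theta>))"
    by (rule has_derivative_compose[of snd snd _ _ a])
       (auto intro!: derivative_eq_intros simp: a_deriv[unfolded has_field_derivative_def])
  have "((\<lambda>z. k * (\<tau> (fst z) (snd z) - a (snd z))) has_derivative
      (\<lambda>h. k * (\<tau>0 * \<tau> r \<theta> * fst h + (\<tau>\<theta> r \<theta> - a' \<theta>) * snd h))) (at (r, \<theta>))"
    by (auto intro!: derivative_eq_intros \<tau>_total_derivative da simp: algebra_simps)
  then have phase: "((\<lambda>z. \<i> * of_real (k * (\<tau> (fst z) (snd z) - a (snd z)))) has_derivative
      (\<lambda>h. \<i> * of_real (k * (\<tau>0 * \<tau> r \<theta> * fst h + (\<tau>\<theta> r \<theta> - a' \<theta>) * snd h)))) (at (r, \<theta>))"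
    by (rule has_derivative_mult_right[OF has_derivative_of_real])
  show ?thesis unfolding w_fun_def
    using has_derivative_compose[OF phase DERIV_exp[unfolded has_field_derivative_def]]
    by (simp add: mult.commute)
qed

lemma hat_grad_w:
  "hat_grad (w_fun a \<tau>0 k) r \<theta> =
     w_fun a \<tau>0 k r \<theta> *s vector [\<i> * of_real (k * (\<tau>0 * \<tau> r \<theta>)), \<i> * of_real (k * ((\<tau>\<theta> r \<theta> - a' \<theta>) / r))]"
  unfolding hat_grad_def partials_of_total_derivative[OF w_total_derivative]
  by (simp add: vec_eq_iff forall_2 field_simps)

text \<open>
The factor \<open>r w / \<tau>\<close>. Conjugation only reverses the sign of the wavenumber, so that \<open>rw (- k)\<close> is the function
\<open>r w\<^sup>* / \<tau>\<close> in the coefficients and one computation of derivatives serves for both.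
\<close>

definition rw where "rw k r \<theta> = of_real (r / \<tau> r \<theta>) * w_fun a \<tau>0 k r \<theta>"

lemma cnj_w: "cnj (w_fun a \<tau>0 k r \<theta>) = w_fun a \<tau>0 (- k) r \<theta>"
  by (simp add: w_fun_def exp_cnj)

lemma w_cancel: "w_fun a \<tau>0 k r \<theta> * w_fun a \<tau>0 (- k) r \<theta> = 1"
  by (simp add: w_fun_def flip: exp_add)

lemma rw_fun_eq: "rw_fun a \<tau>0 k = rw (- k)"
  by (intro ext) (simp add: rw_fun_def rw_def cnj_w)

lemma cnj_rw: "cnj (rw k r \<theta>) = rw (- k) r \<theta>"
  by (simp add: rw_def cnj_w)

lemma rw_total_derivative:
  "((\<lambda>z. rw k (fst z) (snd z)) has_derivative
     (\<lambda>h. (of_real ((fst h * \<tau> r \<theta> - r * (\<tau>0 * \<tau> r \<theta> * fst h + \<tau>\<theta> r \<theta> * snd h)) / (\<tau> r \<theta> * \<tau> r \<theta>))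
       + \<i> * of_real (r / \<tau> r \<theta> * (k * (\<tau>0 * \<tau> r \<theta> * fst h + (\<tau>\<theta> r \<theta> - a' \<theta>) * snd h)))) * w_fun a \<tau>0 k r \<theta>)) (at (r, \<theta>))"
proof -
  have "((\<lambda>z. fst z / \<tau> (fst z) (snd z)) has_derivative
     (\<lambda>h. (fst h * \<tau> r \<theta> - r * (\<tau>0 * \<tau> r \<theta> * fst h + \<tau>\<theta> r \<theta> * snd h)) / (\<tau> r \<theta> * \<tau> r \<theta>))) (at (r, \<theta>))"
    using has_derivative_divide'[OF has_derivative_fst[OF has_derivative_ident] \<tau>_total_derivative, of r \<theta>] \<tau>_pos[of r \<theta>]
    by simp
  from has_derivative_mult[OF has_derivative_of_real[OF this] w_total_derivative]
  show ?thesis unfolding rw_def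
    by (rule has_derivative_eq_rhs) (auto simp: algebra_simps)
qed

lemma hat_grad_rw:
  "0 < r \<Longrightarrow> hat_grad (rw k) r \<theta> =
     w_fun a \<tau>0 k r \<theta> *s vector
       [of_real (1 / \<tau> r \<theta> - r * (\<tau>0 * \<tau> r \<theta>) / (\<tau> r \<theta>)\<^sup>2) + \<i> * of_real (k * r * (\<tau>0 * \<tau> r \<theta>) / \<tau> r \<theta>),
        - of_real (\<tau>\<theta> r \<theta> / (\<tau> r \<theta>)\<^sup>2) + \<i> * of_real (k * (\<tau>\<theta> r \<theta> - a' \<theta>) / \<tau> r \<theta>)]"
  unfolding hat_grad_def partials_of_total_derivative[OF rw_total_derivative]
  using \<tau>_pos[of r \<theta>]
  by (simp add: vec_eq_iff forall_2 field_simps power2_eq_square)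

end

subsection \<open>Two by two matrices\<close>

lemma matrix_mult_2:
  fixes A B :: "'a::semiring_1^2^2"
  shows "(A ** B) $ i $ j = A $ i $ 1 * B $ 1 $ j + A $ i $ 2 * B $ 2 $ j"
  by (simp add: matrix_matrix_mult_def sum_2)

lemma matrix_mult_scaleR:
  fixes X Y :: "real^2^2"
  shows "X ** (c *\<^sub>R Y) = c *\<^sub>R (X ** Y)" "(c *\<^sub>R X) ** Y = c *\<^sub>R (X ** Y)"
  by (simp_all add: vec_eq_iff forall_2 matrix_mult_2 algebra_simps)

lemma rot_orthogonal: "transpose (rot \<theta>) ** rot \<theta> = mat 1" "rot \<theta> ** transpose (rot \<theta>) = mat 1"
  by (simp_all add: vec_eq_iff forall_2 matrix_mult_2 rot_def transpose_def mat_def flip: power2_eq_square)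

lemma matrix_inv_eqI:
  fixes A B :: "real^2^2"
  assumes "A ** B = mat 1" "B ** A = mat 1"
  shows "matrix_inv A = B"
proof -
  have "A ** matrix_inv A = mat 1"
    unfolding matrix_inv_def by (rule someI2[of _ B]) (use assms in auto)
  then have "B ** (A ** matrix_inv A) = B" by simp
  then show ?thesis by (simp add: matrix_mul_assoc assms(2))
qed

context layer_transform
begin

abbreviation "B_entries r \<theta> \<equiv>
  vector [vector [\<tau> r \<theta> / (r * (\<tau>0 * \<tau> r \<theta>)) + (\<tau>\<theta> r \<theta>)\<^sup>2 / (r * (\<tau>0 * \<tau> r \<theta>) * \<tau> r \<theta>), - (\<tau>\<theta> r \<theta> / \<tau> r \<theta>)],
          vector [- (\<tau>\<theta> r \<theta> / \<tau> r \<theta>), r * (\<tau>0 * \<tau> r \<theta>) / \<tau> r \<theta>]] :: real^2^2"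

text \<open>
With \<open>J = R M R\<^sup>T\<close> the rotations cancel and \<open>B = det M \<cdot> N N\<^sup>T\<close> for \<open>N\<close> the inverse of the triangular
matrix \<open>M\<close>.
\<close>

lemma Bmat_eq:
  assumes "0 < r"
  shows "Bmat a \<tau>0 r \<theta> = B_entries r \<theta>"
proof -
  define M :: "real^2^2" where "M = vector [vector [\<tau>0 * \<tau> r \<theta>, \<tau>\<theta> r \<theta> / r], vector [0, \<tau> r \<theta> / r]]"
  define N :: "real^2^2" where "N = vector [vector [1 / (\<tau>0 * \<tau> r \<theta>), - \<tau>\<theta> r \<theta> / (\<tau>0 * \<tau> r \<theta> * \<tau> r \<theta>)], vector [0, r / \<tau> r \<theta>]]"
  define R where "R = rot \<theta>"
  have pos: "0 < \<tau> r \<theta>" "0 < \<tau>0" "0 < r" using \<tau>_pos \<tau>0_pos assms by auto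
  have MN: "M ** N = mat 1" "N ** M = mat 1"
    using pos by (simp_all add: vec_eq_iff forall_2 matrix_mult_2 M_def N_def mat_def field_simps)
  have RR: "transpose R ** R = mat 1" "R ** transpose R = mat 1" unfolding R_def by (rule rot_orthogonal)+
  have J: "Jmat a \<tau>0 r \<theta> = R ** M ** transpose R"
    by (simp add: Jmat_def R_def M_def d_r_\<tau> d_th_\<tau>)
  have cancel: "X ** transpose R ** (R ** Y) = X ** Y" "transpose R ** (R ** Y) = Y" for X Y :: "real^2^2"
    by (metis RR(1) matrix_mul_assoc matrix_mul_rid, metis RR(1) matrix_mul_assoc matrix_mul_lid)
  have Jinv: "matrix_inv (Jmat a \<tau>0 r \<theta>) = R ** N ** transpose R"
    unfolding J
    by (rule matrix_inv_eqI) (metis MN RR cancel matrix_mul_assoc matrix_mul_rid)+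
  have "det (Jmat a \<tau>0 r \<theta>) = det (transpose R ** R) * det M"
    unfolding J by (simp only: det_mul mult_ac)
  moreover have "det M = \<tau>0 * \<tau> r \<theta> * (\<tau> r \<theta> / r)" by (simp add: M_def det_2)
  ultimately have detJ: "det (Jmat a \<tau>0 r \<theta>) = \<tau>0 * \<tau> r \<theta> * (\<tau> r \<theta> / r)"
    by (simp only: RR det_I mult_1)
  have "transpose (R ** N ** transpose R) = R ** transpose N ** transpose R"
    by (simp add: matrix_transpose_mul matrix_mul_assoc)
  then have "Bmat a \<tau>0 r \<theta> = transpose R ** (det (Jmat a \<tau>0 r \<theta>) *\<^sub>R (R ** N ** transpose R ** (R ** transpose N ** transpose R))) ** R"
    by (simp only: Bmat_def Amat_def Jinv R_def)
  also have "\<dots> = det (Jmat a \<tau>0 r \<theta>) *\<^sub>R (transpose R ** (R ** N ** transpose R ** (R ** transpose N ** transpose R)) ** R)"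
    by (simp only: matrix_mult_scaleR)
  also have "transpose R ** (R ** N ** transpose R ** (R ** transpose N ** transpose R)) ** R = N ** transpose N"
    by (metis RR(1) cancel matrix_mul_assoc matrix_mul_rid)
  finally have "Bmat a \<tau>0 r \<theta> = (\<tau>0 * \<tau> r \<theta> * (\<tau> r \<theta> / r)) *\<^sub>R (N ** transpose N)"
    unfolding detJ .
  also have "\<dots> = B_entries r \<theta>"
    using pos
    by (simp add: vec_eq_iff forall_2 matrix_mult_2 N_def transpose_def field_simps power2_eq_square)
  finally show ?thesis .
qed

lemma Amat_eq: "Amat a \<tau>0 r \<theta> = rot \<theta> ** Bmat a \<tau>0 r \<theta> ** transpose (rot \<theta>)"
  unfolding Bmat_def by (metis rot_orthogonal(2) matrix_mul_assoc matrix_mul_lid matrix_mul_rid)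

end

subsection \<open>The bilinear product\<close>

lemma cdot_2: "cdot x y = x $ 1 * y $ 1 + x $ 2 * y $ 2"
  by (simp add: cdot_def sum_2)

lemma cdot_add: "cdot (x + y) z = cdot x z + cdot y z" "cdot x (y + z) = cdot x y + cdot x z"
  by (simp_all add: cdot_2 algebra_simps)

lemma cdot_scale: "cdot (c *s x) y = c * cdot x y" "cdot x (c *s y) = c * cdot x y"
  by (simp_all add: cdot_2 algebra_simps)

lemma cdot_commute: "cdot x y = cdot y x"
  by (simp add: cdot_2 mult.commute)

lemma cdot_matrix: "cdot (M *v x) y = cdot x (transpose M *v y)"
  by (simp add: cdot_2 matrix_vector_mult_def sum_2 transpose_def algebra_simps)

lemma matrix_vector_scale: "(M :: complex^2^2) *v (c *s x) = c *s (M *v x)"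
  by (simp add: vec_eq_iff matrix_vector_mult_def sum_2 algebra_simps)

lemma cmat_mult: "cmat (X ** Y) = cmat X ** cmat Y"
  by (simp add: vec_eq_iff forall_2 matrix_mult_2 cmat_def)

lemma cmat_transpose: "cmat (transpose X) = transpose (cmat X)"
  by (simp add: vec_eq_iff transpose_def cmat_def)

lemma cmat_one: "cmat (mat 1) = mat 1"
  by (simp add: vec_eq_iff mat_def cmat_def)

lemma cnjv_cmat: "cnjv (cmat M *v x) = cmat M *v cnjv x"
  by (simp add: vec_eq_iff cnjv_def cmat_def matrix_vector_mult_def)

lemma cnjv_simps: "cnjv (x + y) = cnjv x + cnjv y" "cnjv (c *s x) = cnj c *s cnjv x" "cnjv (cnjv x) = x"
  by (simp_all add: vec_eq_iff cnjv_def)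

lemma cnj_cdot: "cnj (cdot x y) = cdot (cnjv x) (cnjv y)"
  by (simp add: cdot_2 cnjv_def)

text \<open>
The algebraic core: the four products that arise from the two product rules, with \<open>W\<close> and \<open>cnjv Z\<close> the polar gradients
of the multipliers \<open>w\<close> and \<open>m\<close>.
\<close>

lemma conjugated_product_identity:
  fixes A B R :: "real^2^2" and gv g\<zeta> W Z :: "complex^2"
  assumes R: "transpose R ** R = mat 1" and A: "A = R ** B ** transpose R" and B: "transpose B = B"
  shows "cdot (cmat A *v (w *s gv + v *s (cmat R *v W))) (cnjv (m *s g\<zeta> + \<zeta> *s (cmat R *v cnjv Z)))
     = w * cnj m * cdot (cmat A *v gv) (cnjv g\<zeta>)
     + cdot (cmat R *v (w *s (cmat B *v Z))) gv * cnj \<zeta>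
     + v * cnj (cdot (cmat R *v cnjv (cnj m *s (cmat B *v W))) g\<zeta>)
     + cdot W (cmat B *v Z) * v * cnj \<zeta>"
proof -
  have "A ** R = R ** B" unfolding A by (metis R matrix_mul_assoc matrix_mul_rid)
  then have AR: "cmat A *v (cmat R *v y) = cmat R *v (cmat B *v y)" for y
    by (metis cmat_mult matrix_vector_mul_assoc)
  have "transpose A = A" unfolding A by (simp add: matrix_transpose_mul B matrix_mul_assoc)
  then have symA: "cdot (cmat A *v x) y = cdot x (cmat A *v y)" for x y
    by (metis cdot_matrix cmat_transpose)
  have symB: "cdot (cmat B *v x) y = cdot x (cmat B *v y)" for x y
    by (metis B cdot_matrix cmat_transpose)
  have RR: "cdot (cmat R *v x) (cmat R *v y) = cdot x y" for x y
    by (metis R cdot_matrix cmat_transpose cmat_mult cmat_one matrix_vector_mul_assoc matrix_vector_mul_lid)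
  show ?thesis
    by (simp add: matrix_vector_right_distrib matrix_vector_scale cnjv_simps cnjv_cmat cnj_cdot
        cdot_add cdot_scale AR RR symA symB algebra_simps cdot_commute[of _ gv])
qed

text \<open>
The cancellation behind the zeroth order coefficient: the two contributions proportional to \<open>K\<^sup>2 Tr\<close> and the terms in
\<open>Tt\<^sup>2\<close> drop out. The imaginary unit is abstracted to \<open>J\<close>, which keeps it inert during field arithmetic.
\<close>

lemma reaction_identity:
  fixes r T Tr Tt da K J :: complex
  assumes "r \<noteq> 0" "T \<noteq> 0" "Tr \<noteq> 0" "J * J = -1"
  shows "J * (K * Tr) * (1 / (r * Tr) - 1 / T - J * K - J * (K * Tt * da / T\<^sup>2) + Tt\<^sup>2 / (r * Tr * T\<^sup>2))
    + J * (K * ((Tt - da) / r)) * (- (Tt / T\<^sup>2) + J * (K * r * Tr * da / T\<^sup>2)) - K\<^sup>2 * Tr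
    = J * K * (1 / r - Tr / T + Tt * da / (T\<^sup>2 * r) - J * (K * Tr * da\<^sup>2 / T\<^sup>2))"
proof -
  have e1: "J * (K * Tr) * (1 / (r * Tr) - 1 / T - J * K - J * (K * Tt * da / T\<^sup>2) + Tt\<^sup>2 / (r * Tr * T\<^sup>2))
    = J * K * (1 / r - Tr / T + Tt\<^sup>2 / (r * T\<^sup>2)) - (J * J) * (K\<^sup>2 * Tr + K\<^sup>2 * Tr * Tt * da / T\<^sup>2)"
    using assms(1-3) by (simp add: field_simps power2_eq_square)
  have e2: "J * (K * ((Tt - da) / r)) * (- (Tt / T\<^sup>2) + J * (K * r * Tr * da / T\<^sup>2))
    = - J * K * (Tt - da) * Tt / (r * T\<^sup>2) + (J * J) * K\<^sup>2 * (Tt - da) * Tr * da / T\<^sup>2"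
    using assms(1-3) by (simp add: field_simps power2_eq_square)
  have e3: "J * K * (1 / r - Tr / T + Tt * da / (T\<^sup>2 * r) - J * (K * Tr * da\<^sup>2 / T\<^sup>2))
    = J * K * (1 / r - Tr / T + Tt * da / (T\<^sup>2 * r)) - (J * J) * K\<^sup>2 * Tr * da\<^sup>2 / T\<^sup>2"
    using assms(1-3) by (simp add: field_simps power2_eq_square)
  show ?thesis unfolding e1 e2 e3 assms(4)
    using assms(1-3) by (simp add: field_simps power2_eq_square)
qed

context layer_transform
begin

lemma p_vec_eq:
  assumes "0 < r"
  shows "p_vec a \<tau>0 k r \<theta>
     = vector [of_real (1 / (r * (\<tau>0 * \<tau> r \<theta>))) - of_real (1 / \<tau> r \<theta>) - \<i> * of_real k
                 - \<i> * of_real (k * \<tau>\<theta> r \<theta> * a' \<theta> / (\<tau> r \<theta>)\<^sup>2)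
                 + of_real ((\<tau>\<theta> r \<theta>)\<^sup>2 / (r * (\<tau>0 * \<tau> r \<theta>) * (\<tau> r \<theta>)\<^sup>2)),
               - of_real (\<tau>\<theta> r \<theta> / (\<tau> r \<theta>)\<^sup>2) + \<i> * of_real (k * r * (\<tau>0 * \<tau> r \<theta>) * a' \<theta> / (\<tau> r \<theta>)\<^sup>2)]"
proof -
  have pos: "\<tau> r \<theta> \<noteq> 0" "\<tau>0 \<noteq> 0" "r \<noteq> 0" using \<tau>_pos[of r \<theta>] \<tau>0_pos assms by auto
  have scale: "w *s (M *v (w' *s z)) = (w * w') *s (M *v z)" for w w' z and M :: "complex^2^2"
    by (simp add: matrix_vector_scale vec_eq_iff)
  show ?thesis
    unfolding p_vec_def rw_fun_eq hat_grad_rw[OF assms] scale w_cancel Bmat_eq[OF assms]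
    using pos
    by (simp add: vec_eq_iff forall_2 matrix_vector_mult_def sum_2 cmat_def field_simps power2_eq_square)
qed

lemma q_vec_eq:
  assumes "0 < r"
  shows "q_vec a \<tau>0 k r \<theta>
     = vector [\<i> * of_real k + \<i> * of_real (k * a' \<theta> * \<tau>\<theta> r \<theta> / (\<tau> r \<theta>)\<^sup>2),
               - (\<i> * of_real (k * r * (\<tau>0 * \<tau> r \<theta>) * a' \<theta> / (\<tau> r \<theta>)\<^sup>2))]"
proof -
  have pos: "\<tau> r \<theta> \<noteq> 0" "\<tau>0 \<noteq> 0" "r \<noteq> 0" using \<tau>_pos[of r \<theta>] \<tau>0_pos assms by auto
  have scale: "(c * w') *s (M *v (w *s z)) = (c * (w * w')) *s (M *v z)" for c w w' z and M :: "complex^2^2"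
    by (simp add: matrix_vector_scale vec_eq_iff)
  show ?thesis
    unfolding q_vec_def rw_fun_eq rw_def hat_grad_w scale w_cancel Bmat_eq[OF assms]
    using pos
    by (simp add: vec_eq_iff forall_2 matrix_vector_mult_def sum_2 cmat_def field_simps power2_eq_square)
qed

lemma n_fun_eq:
  assumes "0 < r"
  shows "n_fun a \<tau>0 k r \<theta>
     = \<i> * of_real k * (of_real (1 / r) - of_real (\<tau>0 * \<tau> r \<theta> / \<tau> r \<theta>) + of_real (\<tau>\<theta> r \<theta> * a' \<theta> / ((\<tau> r \<theta>)\<^sup>2 * r))
         - \<i> * of_real (k * (\<tau>0 * \<tau> r \<theta>) * (a' \<theta>)\<^sup>2 / (\<tau> r \<theta>)\<^sup>2))"
proof -
  have pos: "\<tau> r \<theta> \<noteq> 0" "\<tau>0 \<noteq> 0" "r \<noteq> 0" using \<tau>_pos[of r \<theta>] \<tau>0_pos assms by auto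
  have "cdot (w *s x) y = cdot x (w *s y)" for w x y by (simp add: cdot_scale)
  then have "cdot (hat_grad (w_fun a \<tau>0 k) r \<theta>) (cmat (Bmat a \<tau>0 r \<theta>) *v hat_grad (rw_fun a \<tau>0 k) r \<theta>)
    = cdot (vector [\<i> * of_real (k * (\<tau>0 * \<tau> r \<theta>)), \<i> * of_real (k * ((\<tau>\<theta> r \<theta> - a' \<theta>) / r))]) (p_vec a \<tau>0 k r \<theta>)"
    unfolding p_vec_def hat_grad_w by simp
  then show ?thesis
    unfolding n_fun_def p_vec_eq[OF assms] d_r_\<tau>
    using pos reaction_identity[of "of_real r" "of_real (\<tau> r \<theta>)" "of_real (\<tau>0 * \<tau> r \<theta>)" \<i>
        "of_real k" "of_real (\<tau>\<theta> r \<theta>)" "of_real (a' \<theta>)"]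
    by (simp only: cdot_2 vector_2 of_real_mult of_real_divide of_real_power of_real_1 of_real_diff
        of_real_eq_0_iff mult_eq_0_iff i_squared simp_thms)
qed

lemma polar_coeff_a: "polar_coeff (\<lambda>r. a)" and polar_coeff_a': "polar_coeff (\<lambda>r. a')"
  by (intro polar_coeff_radial a_cont a_periodic a'_cont a'_periodic)+

lemma polar_coeff_\<tau>: "polar_coeff \<tau>"
  unfolding tau_def by (intro polar_coeff_intros polar_coeff_a)

lemma polar_coeff_\<tau>\<theta>: "polar_coeff \<tau>\<theta>"
  unfolding \<tau>\<theta>_def by (intro polar_coeff_intros polar_coeff_a polar_coeff_a')

lemmas layer_coeff_intros = polar_coeff_intros polar_coeff_a polar_coeff_a' polar_coeff_\<tau> polar_coeff_\<tau>\<theta>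

lemma polar_coeff_w: "polar_coeff (w_fun a \<tau>0 k)"
  unfolding w_fun_def by (intro layer_coeff_intros)

lemma polar_coeff_radius_over_\<tau>: "polar_coeff (\<lambda>r \<theta>. r / \<tau> r \<theta>)"
  by (intro layer_coeff_intros) (use \<tau>_pos in \<open>simp add: less_imp_neq[symmetric]\<close>)

lemma polar_coeff_rw: "polar_coeff (rw k)"
  unfolding rw_def[abs_def] by (intro polar_coeff_mult polar_coeff_of_real polar_coeff_radius_over_\<tau> polar_coeff_w)

lemma polar_coeff_rot: "polar_coeff (\<lambda>r \<theta>. rot \<theta> $ i $ j)"
  using exhaust_2[of i] exhaust_2[of j] by (auto simp: rot_def intro!: polar_coeff_intros)

lemma \<tau>_nonzero: "\<tau> r \<theta> \<noteq> 0"
  using \<tau>_pos[of r \<theta>] by simp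

lemma polar_coeff_B: "polar_coeff (\<lambda>r \<theta>. Bmat a \<tau>0 r \<theta> $ i $ j)"
proof (rule polar_coeff_cong)
  show "Bmat a \<tau>0 r \<theta> $ i $ j = B_entries r \<theta> $ i $ j" if "0 < r" for r \<theta>
    using Bmat_eq[OF that] by simp
  show "polar_coeff (\<lambda>r \<theta>. B_entries r \<theta> $ i $ j)"
    using exhaust_2[of i] exhaust_2[of j] \<tau>_nonzero \<tau>0_pos
    by (auto intro!: layer_coeff_intros)
qed

lemma polar_coeff_A: "polar_coeff (\<lambda>r \<theta>. Amat a \<tau>0 r \<theta> $ i $ j)"
  unfolding Amat_eq matrix_mult_2 transpose_def vec_lambda_beta
  by (intro polar_coeff_add polar_coeff_mult polar_coeff_rot polar_coeff_B)

lemma polar_coeff_cmat_vec: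
  assumes "\<And>i j. polar_coeff (\<lambda>r \<theta>. M r \<theta> $ i $ j)" "\<And>j. polar_coeff (\<lambda>r \<theta>. x r \<theta> $ j)"
  shows "polar_coeff (\<lambda>r \<theta>. (cmat (M r \<theta>) *v x r \<theta>) $ i)"
  unfolding matrix_vector_mult_def cmat_def vec_lambda_beta sum_2
  by (intro polar_coeff_add polar_coeff_mult polar_coeff_of_real assms)

lemma polar_coeff_hat_grad_w: "polar_coeff (\<lambda>r \<theta>. hat_grad (w_fun a \<tau>0 k) r \<theta> $ i)"
  unfolding hat_grad_w using exhaust_2[of i]
  by (auto intro!: layer_coeff_intros polar_coeff_w)

lemma polar_coeff_hat_grad_rw: "polar_coeff (\<lambda>r \<theta>. hat_grad (rw k) r \<theta> $ i)"
proof (rule polar_coeff_cong)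
  show "hat_grad (rw k) r \<theta> $ i = (w_fun a \<tau>0 k r \<theta> *s vector
       [of_real (1 / \<tau> r \<theta> - r * (\<tau>0 * \<tau> r \<theta>) / (\<tau> r \<theta>)\<^sup>2) + \<i> * of_real (k * r * (\<tau>0 * \<tau> r \<theta>) / \<tau> r \<theta>),
        - of_real (\<tau>\<theta> r \<theta> / (\<tau> r \<theta>)\<^sup>2) + \<i> * of_real (k * (\<tau>\<theta> r \<theta> - a' \<theta>) / \<tau> r \<theta>)]) $ i" if "0 < r" for r \<theta>
    using hat_grad_rw[OF that] by simp
  show "polar_coeff (\<lambda>r \<theta>. (w_fun a \<tau>0 k r \<theta> *s vector
       [of_real (1 / \<tau> r \<theta> - r * (\<tau>0 * \<tau> r \<theta>) / (\<tau> r \<theta>)\<^sup>2) + \<i> * of_real (k * r * (\<tau>0 * \<tau> r \<theta>) / \<tau> r \<theta>),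
        - of_real (\<tau>\<theta> r \<theta> / (\<tau> r \<theta>)\<^sup>2) + \<i> * of_real (k * (\<tau>\<theta> r \<theta> - a' \<theta>) / \<tau> r \<theta>)]) $ i)"
    using exhaust_2[of i] \<tau>_nonzero by (auto intro!: layer_coeff_intros polar_coeff_w)
qed

lemma polar_coeff_p: "polar_coeff (\<lambda>r \<theta>. p_vec a \<tau>0 k r \<theta> $ i)"
  unfolding p_vec_def rw_fun_eq vector_smult_component
  by (intro polar_coeff_mult polar_coeff_w polar_coeff_cmat_vec polar_coeff_B polar_coeff_hat_grad_rw)

lemma polar_coeff_q: "polar_coeff (\<lambda>r \<theta>. q_vec a \<tau>0 k r \<theta> $ i)"
  unfolding q_vec_def rw_fun_eq vector_smult_component
  by (intro polar_coeff_mult polar_coeff_rw polar_coeff_cmat_vec polar_coeff_B polar_coeff_hat_grad_w)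

lemma polar_coeff_d_r_\<tau>: "polar_coeff (d_r \<tau>)"
  unfolding d_r_\<tau>[abs_def] by (intro layer_coeff_intros)

lemma polar_coeff_n: "polar_coeff (n_fun a \<tau>0 k)"
  unfolding n_fun_def[abs_def] rw_fun_eq cdot_2
  by (intro polar_coeff_diff polar_coeff_add polar_coeff_mult polar_coeff_of_real polar_coeff_const
      polar_coeff_cmat_vec polar_coeff_B polar_coeff_hat_grad_rw polar_coeff_hat_grad_w polar_coeff_d_r_\<tau>)

end

section \<open>Expansion of the sesquilinear form\<close>

lemma set_borel_measurable_add:
  fixes f g :: "real^2 \<Rightarrow> complex"
  shows "set_borel_measurable M A f \<Longrightarrow> set_borel_measurable M A g \<Longrightarrow> set_borel_measurable M A (\<lambda>x. f x + g x)"
  unfolding set_borel_measurable_def scaleR_add_right by (rule borel_measurable_add)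

lemma set_borel_measurable_mult:
  fixes f g :: "real^2 \<Rightarrow> complex"
  assumes "set_borel_measurable M A f" "set_borel_measurable M A g"
  shows "set_borel_measurable M A (\<lambda>x. f x * g x)"
proof -
  have "(\<lambda>x. indicat_real A x *\<^sub>R f x * (indicat_real A x *\<^sub>R g x)) \<in> borel_measurable M"
    using assms unfolding set_borel_measurable_def by (rule borel_measurable_times)
  then show ?thesis
    unfolding set_borel_measurable_def
    by (rule measurable_cong[THEN iffD1, rotated]) (auto simp: indicator_def)
qed

lemma set_borel_measurable_cnj:
  assumes "set_borel_measurable M A f"
  shows "set_borel_measurable M A (\<lambda>x. cnj (f x))"
proof -
  have "(\<lambda>x. cnj (indicat_real A x *\<^sub>R f x)) \<in> borel_measurable M"
    using assms unfolding set_borel_measurable_def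
    by (rule measurable_compose) (intro borel_measurable_continuous_onI continuous_intros)
  then show ?thesis by (simp add: set_borel_measurable_def)
qed

context layer_transform
begin

abbreviation \<Omega> :: "(real^2) set" where "\<Omega> \<equiv> Omega2 a b"

lemma is_weak_gradient_on_plane_mult:
  assumes "is_weak_gradient \<Omega> u g" "polar_coeff f" "\<And>i. polar_coeff (\<lambda>r \<theta>. hat_grad f r \<theta> $ i)"
    and der: "\<And>r \<theta>. ((\<lambda>z. f (fst z) (snd z)) has_derivative D r \<theta>) (at (r, \<theta>))"
  shows "is_weak_gradient \<Omega> (\<lambda>x. on_plane f x * u x)
     (\<lambda>x. on_plane f x *s g x + u x *s on_plane (\<lambda>r \<theta>. cmat (rot \<theta>) *v hat_grad f r \<theta>) x)"
proof (rule is_weak_gradient_mult[OF open_Omega2 assms(1)])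
  show "(on_plane f has_derivative
     (\<lambda>h. \<Sum>j\<in>UNIV. of_real (h $ j) * on_plane (\<lambda>r \<theta>. cmat (rot \<theta>) *v hat_grad f r \<theta>) x $ j)) (at x)"
    if "x \<in> \<Omega>" for x
    by (rule has_derivative_on_plane[OF _ Omega2_nonzero[OF that] der])
       (use assms(2) in \<open>simp add: polar_coeff_def\<close>)
  show "continuous_on \<Omega> (\<lambda>x. on_plane (\<lambda>r \<theta>. cmat (rot \<theta>) *v hat_grad f r \<theta>) x $ j)" for j
    using continuous_on_plane[OF polar_coeff_cmat_vec[OF polar_coeff_rot assms(3), of j]]
    by (simp add: on_plane_def[abs_def])
qed

lemma set_integrable_coeff_product:
  assumes "polar_coeff c" "square_integrable \<Omega> u" "square_integrable \<Omega> v"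
  shows "set_integrable lebesgue \<Omega> (\<lambda>x. on_plane c x * (u x * cnj (v x)))"
  by (rule square_integrable_product[OF open_Omega2 assms(2,3) continuous_on_plane[OF assms(1)] bounded_on_plane[OF assms(1)]])

lemma hat_grad_rw_cnj: "0 < r \<Longrightarrow> hat_grad (rw k) r \<theta> = cnjv (hat_grad (rw (- k)) r \<theta>)"
  by (simp add: hat_grad_rw cnjv_def vec_eq_iff forall_2 cnj_w)

lemma transpose_B: "0 < r \<Longrightarrow> transpose (Bmat a \<tau>0 r \<theta>) = Bmat a \<tau>0 r \<theta>"
  by (simp add: Bmat_eq transpose_def vec_eq_iff forall_2)

text \<open>
The last summand compensates the \<open>- k\<^sup>2 \<tau>\<^sub>r\<close> that is contained in \<open>n_fun\<close>; after integration it cancels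
against the second term of the original form.
\<close>

lemma integrand_expansion:
  assumes "0 < r"
  shows "cdot (cmat (Amat a \<tau>0 r \<theta>) *v (w_fun a \<tau>0 k r \<theta> *s gv + v *s (cmat (rot \<theta>) *v hat_grad (w_fun a \<tau>0 k) r \<theta>)))
       (cnjv (rw k r \<theta> *s g\<zeta> + \<zeta> *s (cmat (rot \<theta>) *v hat_grad (rw k) r \<theta>)))
     = cdot (of_real (r / \<tau> r \<theta>) *s (cmat (Amat a \<tau>0 r \<theta>) *v gv)) (cnjv g\<zeta>)
     + cdot (cmat (rot \<theta>) *v p_vec a \<tau>0 k r \<theta>) gv * cnj \<zeta>
     + v * cnj (cdot (cmat (rot \<theta>) *v cnjv (q_vec a \<tau>0 k r \<theta>)) g\<zeta>)
     + n_fun a \<tau>0 k r \<theta> * v * cnj \<zeta>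
     + of_real (k\<^sup>2) * (of_real (d_r \<tau> r \<theta>) * v * cnj \<zeta>)"
proof -
  have "w_fun a \<tau>0 k r \<theta> * cnj (rw k r \<theta>) = of_real (r / \<tau> r \<theta>) * (w_fun a \<tau>0 k r \<theta> * w_fun a \<tau>0 (- k) r \<theta>)"
    unfolding cnj_rw by (simp only: rw_def mult_ac)
  then have m: "w_fun a \<tau>0 k r \<theta> * cnj (rw k r \<theta>) = of_real (r / \<tau> r \<theta>)" unfolding w_cancel by simp
  show ?thesis
    unfolding hat_grad_rw_cnj[OF assms, of k \<theta>] conjugated_product_identity[OF rot_orthogonal(1) Amat_eq transpose_B[OF assms]] m
    by (simp add: p_vec_def q_vec_def n_fun_def rw_fun_eq cnj_rw cdot_scale algebra_simps)
qed

text \<open>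
Both products have weak gradients given by the product rule up to a null set, so the integrand of the original form agrees
almost everywhere with the sum of five integrable functions.
\<close>

lemma form_expansion:
  assumes v: "v \<in> H1 \<Omega>" and \<zeta>: "\<zeta> \<in> H1 \<Omega>"
  shows "inner_v \<Omega>
          (\<lambda>x. cmat (on_plane (Amat a \<tau>0) x) *v weak_gradient \<Omega> (\<lambda>y. on_plane (w_fun a \<tau>0 k) y * v y) x)
          (weak_gradient \<Omega> (\<lambda>y. on_plane (\<lambda>r \<theta>. of_real (r / tau a \<tau>0 r \<theta>) * w_fun a \<tau>0 k r \<theta>) y * \<zeta> y))
        - of_real (k\<^sup>2) * inner_s \<Omega> (\<lambda>x. of_real (on_plane (d_r (tau a \<tau>0)) x) * v x) \<zeta>
      = form_At a b \<tau>0 k v \<zeta>"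
proof -
  define gv where "gv = weak_gradient \<Omega> v"
  define g\<zeta> where "g\<zeta> = weak_gradient \<Omega> \<zeta>"
  define Gv where "Gv = weak_gradient \<Omega> (\<lambda>y. on_plane (w_fun a \<tau>0 k) y * v y)"
  define G\<zeta> where "G\<zeta> = weak_gradient \<Omega> (\<lambda>y. on_plane (rw k) y * \<zeta> y)"
  have sq: "square_integrable \<Omega> v" "square_integrable \<Omega> \<zeta>"
    "\<And>i. square_integrable \<Omega> (\<lambda>x. gv x $ i)" "\<And>i. square_integrable \<Omega> (\<lambda>x. g\<zeta> x $ i)"
    unfolding gv_def g\<zeta>_def using H1D[OF open_Omega2 v] H1D[OF open_Omega2 \<zeta>] by blast+
  have wg: "is_weak_gradient \<Omega> v gv" "is_weak_gradient \<Omega> \<zeta> g\<zeta>"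
    unfolding gv_def g\<zeta>_def using H1D(2)[OF open_Omega2] v \<zeta> by blast+
  have P1: "is_weak_gradient \<Omega> (\<lambda>y. on_plane (w_fun a \<tau>0 k) y * v y)
     (\<lambda>x. on_plane (w_fun a \<tau>0 k) x *s gv x + v x *s on_plane (\<lambda>r \<theta>. cmat (rot \<theta>) *v hat_grad (w_fun a \<tau>0 k) r \<theta>) x)"
    by (rule is_weak_gradient_on_plane_mult[OF wg(1) polar_coeff_w polar_coeff_hat_grad_w w_total_derivative])
  have P2: "is_weak_gradient \<Omega> (\<lambda>y. on_plane (rw k) y * \<zeta> y)
     (\<lambda>x. on_plane (rw k) x *s g\<zeta> x + \<zeta> x *s on_plane (\<lambda>r \<theta>. cmat (rot \<theta>) *v hat_grad (rw k) r \<theta>) x)"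
    by (rule is_weak_gradient_on_plane_mult[OF wg(2) polar_coeff_rw polar_coeff_hat_grad_rw rw_total_derivative])
  define T1 where "T1 x = cdot (of_real (on_plane (\<lambda>r \<theta>. r / \<tau> r \<theta>) x) *s (cmat (on_plane (Amat a \<tau>0) x) *v gv x)) (cnjv (g\<zeta> x))" for x
  define T2 where "T2 x = cdot (on_plane (\<lambda>r \<theta>. cmat (rot \<theta>) *v p_vec a \<tau>0 k r \<theta>) x) (gv x) * cnj (\<zeta> x)" for x
  define T3 where "T3 x = v x * cnj (cdot (on_plane (\<lambda>r \<theta>. cmat (rot \<theta>) *v cnjv (q_vec a \<tau>0 k r \<theta>)) x) (g\<zeta> x))" for x
  define T4 where "T4 x = on_plane (n_fun a \<tau>0 k) x * v x * cnj (\<zeta> x)" for x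
  define T5 where "T5 x = of_real (on_plane (d_r \<tau>) x) * v x * cnj (\<zeta> x)" for x
  define F where "F x = cdot (cmat (on_plane (Amat a \<tau>0) x) *v Gv x) (cnjv (G\<zeta> x))" for x
  have F_AE: "AE x in lebesgue. x \<in> \<Omega> \<longrightarrow> F x = T1 x + T2 x + T3 x + T4 x + of_real (k\<^sup>2) * T5 x"
    using weak_gradient_AE_eq[OF open_Omega2 P1] weak_gradient_AE_eq[OF open_Omega2 P2]
  proof eventually_elim
    case (elim x)
    show ?case
    proof
      assume x: "x \<in> \<Omega>"
      have r: "0 < norm x" using Omega2_nonzero[OF x] by simp
      show "F x = T1 x + T2 x + T3 x + T4 x + of_real (k\<^sup>2) * T5 x"
        unfolding F_def Gv_def G\<zeta>_def elim(1)[rule_format, OF x] elim(2)[rule_format, OF x] T1_def T2_def T3_def T4_def T5_def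
        unfolding on_plane_def by (rule integrand_expansion[OF r])
    qed
  qed
  have coeff_A: "polar_coeff (\<lambda>r \<theta>. complex_of_real (r / \<tau> r \<theta> * Amat a \<tau>0 r \<theta> $ i $ j))" for i j
    by (intro polar_coeff_of_real polar_coeff_mult polar_coeff_radius_over_\<tau> polar_coeff_A)
  have coeff_p: "polar_coeff (\<lambda>r \<theta>. (cmat (rot \<theta>) *v p_vec a \<tau>0 k r \<theta>) $ i)" for i
    by (intro polar_coeff_cmat_vec polar_coeff_rot polar_coeff_p)
  have coeff_q: "polar_coeff (\<lambda>r \<theta>. (cmat (rot \<theta>) *v q_vec a \<tau>0 k r \<theta>) $ i)" for i
    by (intro polar_coeff_cmat_vec polar_coeff_rot polar_coeff_q)
  have int1: "set_integrable lebesgue \<Omega> T1"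
  proof -
    have "T1 = (\<lambda>x. \<Sum>i\<in>UNIV. \<Sum>j\<in>UNIV. on_plane (\<lambda>r \<theta>. complex_of_real (r / \<tau> r \<theta> * Amat a \<tau>0 r \<theta> $ i $ j)) x * (gv x $ j * cnj (g\<zeta> x $ i)))"
      by (rule ext) (simp add: T1_def on_plane_def cdot_2 cnjv_def matrix_vector_mult_def cmat_def sum_2 algebra_simps)
    then show ?thesis
      by (simp only: sum_2) (intro set_integral_add(1) set_integrable_coeff_product coeff_A sq)
  qed
  have int2: "set_integrable lebesgue \<Omega> T2"
  proof -
    have "T2 = (\<lambda>x. \<Sum>i\<in>UNIV. on_plane (\<lambda>r \<theta>. (cmat (rot \<theta>) *v p_vec a \<tau>0 k r \<theta>) $ i) x * (gv x $ i * cnj (\<zeta> x)))"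
      by (rule ext) (simp add: T2_def on_plane_def cdot_2 sum_2 algebra_simps)
    then show ?thesis
      by (simp only: sum_2) (intro set_integral_add(1) set_integrable_coeff_product coeff_p sq)
  qed
  have int3: "set_integrable lebesgue \<Omega> T3"
  proof -
    have "T3 = (\<lambda>x. \<Sum>i\<in>UNIV. on_plane (\<lambda>r \<theta>. (cmat (rot \<theta>) *v q_vec a \<tau>0 k r \<theta>) $ i) x * (v x * cnj (g\<zeta> x $ i)))"
      by (rule ext) (simp add: T3_def on_plane_def cnj_cdot cnjv_cmat cnjv_simps, simp add: cdot_2 sum_2 cnjv_def algebra_simps)
    then show ?thesis
      by (simp only: sum_2) (intro set_integral_add(1) set_integrable_coeff_product coeff_q sq)
  qed
  have int4: "set_integrable lebesgue \<Omega> T4"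
    using set_integrable_coeff_product[OF polar_coeff_n sq(1,2)] by (simp add: T4_def[abs_def] mult.assoc)
  have int5: "set_integrable lebesgue \<Omega> T5"
    using set_integrable_coeff_product[OF polar_coeff_of_real[OF polar_coeff_d_r_\<tau>] sq(1,2)]
    by (simp add: T5_def[abs_def] mult.assoc on_plane_def)
  have measG: "set_borel_measurable lebesgue \<Omega> (\<lambda>x. Gv x $ i)" "set_borel_measurable lebesgue \<Omega> (\<lambda>x. G\<zeta> x $ i)" for i
    using weak_gradient_is[OF P1] weak_gradient_is[OF P2] unfolding Gv_def G\<zeta>_def is_weak_gradient_def
    by (blast intro: set_borel_measurable_if_locally_integrable[OF open_Omega2])+
  have measA: "set_borel_measurable lebesgue \<Omega> (\<lambda>x. complex_of_real (on_plane (Amat a \<tau>0) x $ i $ j))" for i j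
    using set_borel_measurable_continuous_lebesgue[OF continuous_on_plane[OF polar_coeff_of_real[OF polar_coeff_A[of i j]]]]
      borel_open[OF open_Omega2]
    by (simp add: on_plane_def[abs_def])
  \<comment> \<open>equality of the integrals of functions that agree almost everywhere presupposes measurability of both\<close>
  have measF: "set_borel_measurable lebesgue \<Omega> F"
    unfolding F_def[abs_def] cdot_2 cnjv_def matrix_vector_mult_def cmat_def sum_2 vec_lambda_beta
    by (intro set_borel_measurable_add set_borel_measurable_mult set_borel_measurable_cnj measG measA)
  have rhs: "set_integrable lebesgue \<Omega> (\<lambda>x. T1 x + T2 x + T3 x + T4 x + of_real (k\<^sup>2) * T5 x)"
    by (intro set_integral_add(1) set_integrable_mult_right int1 int2 int3 int4 int5)
  have "(LINT x:\<Omega>|lebesgue. F x) = (LINT x:\<Omega>|lebesgue. T1 x + T2 x + T3 x + T4 x + of_real (k\<^sup>2) * T5 x)"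
    unfolding set_lebesgue_integral_def
  proof (rule integral_cong_AE)
    show "(\<lambda>x. indicat_real \<Omega> x *\<^sub>R F x) \<in> borel_measurable lebesgue"
      using measF by (simp add: set_borel_measurable_def)
    show "(\<lambda>x. indicat_real \<Omega> x *\<^sub>R (T1 x + T2 x + T3 x + T4 x + of_real (k\<^sup>2) * T5 x)) \<in> borel_measurable lebesgue"
      using rhs unfolding set_integrable_def by (rule borel_measurable_integrable)
    show "AE x in lebesgue. indicat_real \<Omega> x *\<^sub>R F x = indicat_real \<Omega> x *\<^sub>R (T1 x + T2 x + T3 x + T4 x + of_real (k\<^sup>2) * T5 x)"
      using F_AE by eventually_elim (auto simp: indicator_def)
  qed
  also have "\<dots> = (LINT x:\<Omega>|lebesgue. T1 x) + (LINT x:\<Omega>|lebesgue. T2 x) + (LINT x:\<Omega>|lebesgue. T3 x)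
      + (LINT x:\<Omega>|lebesgue. T4 x) + of_real (k\<^sup>2) * (LINT x:\<Omega>|lebesgue. T5 x)"
    by (simp only: set_integral_add set_integrable_mult_right set_integral_mult_right int1 int2 int3 int4 int5 simp_thms)
  finally show ?thesis
    unfolding form_At_def inner_v_def inner_s_def gv_def[symmetric] g\<zeta>_def[symmetric] rw_def[symmetric]
      Gv_def[symmetric] G\<zeta>_def[symmetric]
    by (simp add: F_def T1_def T2_def T3_def T4_def T5_def)
qed

end

theorem theorem4p1:
  fixes a b :: "real \<Rightarrow> real" and \<tau>0 \<omega> \<rho> lam \<mu> :: real and k :: "wave \<Rightarrow> real"
  assumes a_C1: "a C1_differentiable_on UNIV"
    and a_periodic: "\<And>\<theta>. a (\<theta> + 2 * pi) = a \<theta>"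
    and b_cont: "continuous_on UNIV b"
    and b_periodic: "\<And>\<theta>. b (\<theta> + 2 * pi) = b \<theta>"
    and a_pos: "\<And>\<theta>. 0 < a \<theta>"
    and a_less_b: "\<And>\<theta>. a \<theta> < b \<theta>"
    and tau0_pos: "0 < \<tau>0"
    and params: "0 < \<omega>" "0 < \<rho>" "0 < \<mu>" "0 < lam + \<mu>"
    and k_def: "k = wavenumber \<omega> \<rho> lam \<mu>"
  shows "(\<forall>v \<zeta>. (\<forall>t. v t \<in> H1 (Omega2 a b)) \<longrightarrow> (\<forall>t. \<zeta> t \<in> H1 (Omega2 a b)) \<longrightarrow>
            form_A a b \<tau>0 k v \<zeta>
            = form_At a b \<tau>0 (k P) (v P) (\<zeta> P) + form_At a b \<tau>0 (k S) (v S) (\<zeta> S))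
    \<and> (\<forall>r \<theta> \<tau> \<tau>r \<tau>\<theta> a\<theta>. a \<theta> < r \<longrightarrow> r < b \<theta> \<longrightarrow>
          \<tau> = tau a \<tau>0 r \<theta> \<longrightarrow> \<tau>r = d_r (tau a \<tau>0) r \<theta> \<longrightarrow> \<tau>\<theta> = d_th (tau a \<tau>0) r \<theta> \<longrightarrow>
          a\<theta> = deriv a \<theta> \<longrightarrow>
          Bmat a \<tau>0 r \<theta>
            = vector [vector [\<tau> / (r * \<tau>r) + \<tau>\<theta>\<^sup>2 / (r * \<tau>r * \<tau>), - (\<tau>\<theta> / \<tau>)],
                      vector [- (\<tau>\<theta> / \<tau>), r * \<tau>r / \<tau>]]
          \<and> (\<forall>t. p_vec a \<tau>0 (k t) r \<theta>
               = vector [of_real (1 / (r * \<tau>r)) - of_real (1 / \<tau>) - \<i> * of_real (k t)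
                           - \<i> * of_real (k t * \<tau>\<theta> * a\<theta> / \<tau>\<^sup>2) + of_real (\<tau>\<theta>\<^sup>2 / (r * \<tau>r * \<tau>\<^sup>2)),
                         - of_real (\<tau>\<theta> / \<tau>\<^sup>2) + \<i> * of_real (k t * r * \<tau>r * a\<theta> / \<tau>\<^sup>2)]
             \<and> q_vec a \<tau>0 (k t) r \<theta>
               = vector [\<i> * of_real (k t) + \<i> * of_real (k t * a\<theta> * \<tau>\<theta> / \<tau>\<^sup>2),
                         - (\<i> * of_real (k t * r * \<tau>r * a\<theta> / \<tau>\<^sup>2))]
             \<and> n_fun a \<tau>0 (k t) r \<theta>
               = \<i> * of_real (k t) *
                   (of_real (1 / r) - of_real (\<tau>r / \<tau>) + of_real (\<tau>\<theta> * a\<theta> / (\<tau>\<^sup>2 * r))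
                    - \<i> * of_real (k t * \<tau>r * a\<theta>\<^sup>2 / \<tau>\<^sup>2))))"
proof -
  interpret layer_transform a b \<tau>0
  proof
    show "continuous_on UNIV a" using a_C1 by (rule C1_differentiable_imp_continuous_on)
  qed fact+
  show ?thesis
  proof (intro conjI allI impI)
    fix v \<zeta> :: "wave \<Rightarrow> real^2 \<Rightarrow> complex"
    assume H: "\<forall>t. v t \<in> H1 \<Omega>" "\<forall>t. \<zeta> t \<in> H1 \<Omega>"
    show "form_A a b \<tau>0 k v \<zeta> = form_At a b \<tau>0 (k P) (v P) (\<zeta> P) + form_At a b \<tau>0 (k S) (v S) (\<zeta> S)"
      unfolding form_A_def form_expansion[OF H(1)[rule_format] H(2)[rule_format]] by simp
  next
    fix r \<theta> T Tr Tt da t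
    assume "a \<theta> < r" and eqs: "T = tau a \<tau>0 r \<theta>" "Tr = d_r (tau a \<tau>0) r \<theta>" "Tt = d_th (tau a \<tau>0) r \<theta>" "da = deriv a \<theta>"
    then have r: "0 < r" using a_pos[of \<theta>] by simp
    show "Bmat a \<tau>0 r \<theta> = vector [vector [T / (r * Tr) + Tt\<^sup>2 / (r * Tr * T), - (Tt / T)], vector [- (Tt / T), r * Tr / T]]"
      unfolding eqs d_r_\<tau> d_th_\<tau> by (rule Bmat_eq[OF r])
    show "p_vec a \<tau>0 (k t) r \<theta>
       = vector [of_real (1 / (r * Tr)) - of_real (1 / T) - \<i> * of_real (k t)
                   - \<i> * of_real (k t * Tt * da / T\<^sup>2) + of_real (Tt\<^sup>2 / (r * Tr * T\<^sup>2)),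
                 - of_real (Tt / T\<^sup>2) + \<i> * of_real (k t * r * Tr * da / T\<^sup>2)]"
      unfolding eqs d_r_\<tau> d_th_\<tau> by (rule p_vec_eq[OF r])
    show "q_vec a \<tau>0 (k t) r \<theta>
       = vector [\<i> * of_real (k t) + \<i> * of_real (k t * da * Tt / T\<^sup>2), - (\<i> * of_real (k t * r * Tr * da / T\<^sup>2))]"
      unfolding eqs d_r_\<tau> d_th_\<tau> by (rule q_vec_eq[OF r])
    show "n_fun a \<tau>0 (k t) r \<theta>
       = \<i> * of_real (k t) * (of_real (1 / r) - of_real (Tr / T) + of_real (Tt * da / (T\<^sup>2 * r))
            - \<i> * of_real (k t * Tr * da\<^sup>2 / T\<^sup>2))"
      unfolding eqs d_r_\<tau> d_th_\<tau> by (rule n_fun_eq[OF r])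
  qed
qed

end
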